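(* Fix an integer $m\ge2$. For every $n\in\mathbb{N}$ and every $\mathcal{A}\in\mathbb{S}_{m,n}$, checking whether $\mathcal{A}$ is an $H^+$-tensor (equivalently, a GDD$^+$ tensor) is equivalent to solving a power cone optimization problem of size polynomial in $n$. Precisely: $\mathcal{A}$ is an $H^+$-tensor if and only if the power cone feasibility problem $\mathrm{P}(\mathcal{A})$ defined in the context has a feasible solution, and the number of scalar variables, linear inequalities and three-dimensional power cone constraints of $\mathrm{P}(\mathcal{A})$ is bounded by a polynomial in $n$ (depending only on $m$).
   Context: $\mathbb{S}_{m,n}$ is the set of real symmetric tensors $\mathcal{A}=(a_{i_1\dots i_m})$ of order $m$ and dimension $n$ (indices in $[n]=\{1,\dots,n\}$). Diagonal elements are the entries $a_{ii\dots i}$; $\mathcal{I}$ is the diagonal tensor with all diagonal elements $1$ (and off-diagonal elements $0$). Eigenvalues: $\lambda\in\mathbb{C}$ is an eigenvalue of $\mathcal{A}$ if there is $x\in\mathbb{C}^n\setminus\{0\}$ with $\sum_{i_2,\dots,i_m}a_{ii_2\dots i_m}x_{i_2}\cdots x_{i_m}=\lambda x_i^{m-1}$ for all $i$; $\rho(\mathcal{A})$ is the largest modulus of the eigenvalues. A $Z$-tensor is a tensor $s\mathcal{I}-\mathcal{D}$ with $s\ge0$ and $\mathcal{D}$ entrywise nonnegative; it is an $M$-tensor if $s\ge\rho(\mathcal{D})$. The comparison tensor $M(\mathcal{A})$ has diagonal elements $|a_{i\dots i}|$ and off-diagonal elements $-|a_{i_1\dots i_m}|$. $\mathcal{A}$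 is an $H$-tensor if $M(\mathcal{A})$ is an $M$-tensor, and an $H^+$-tensor if in addition its diagonal elements are nonnegative. $\mathcal{A}$ is diagonally dominant (DD) if $|a_{ii\dots i}|\ge\sum_{(i_2,\dots,i_m)\ne(i,\dots,i)}|a_{ii_2\dots i_m}|$ for all $i$; it is GDD if for some positive $d_1,\dots,d_n$ the tensor with entries $a_{i_1\dots i_m}d_{i_1}^{1-m}d_{i_2}\cdots d_{i_m}$ is DD; GDD$^+$ means GDD with nonnegative diagonal elements. It is known that a symmetric tensor is an $H$-tensor if and only if it is GDD. $\mathscr{D}_n^m$ is the set of $\vec{i}=(i_1,\dots,i_m)$ with $1\le i_1\le\cdots\le i_m\le n$ not all equal; $j\in\vec{i}$ means $j\in\{i_1,\dots,i_m\}$; $a_{\vec{i}}=a_{i_1\dots i_m}$. For $\vec{i}\in\mathscr{D}_n^m$ with distinct values $j_1<\dots<j_l$ of multiplicities $\alpha=(\alpha_1,\dots,\alpha_l)$, $c(\vec{i})=\prod_{k=1}^l\binom{m-1}{\alpha-e_k}^{\alpha_k}$ (multinomial coefficients; $e_k$ the $k$-th unit vector of $\mathbb{R}^l$). For $\alpha\in[0,1]$ the power cone is $\mathbb{K}_\alpha=\{(x_1,x_2,z)\in\mathbb{R}_+^2\times\mathbb{R}: x_1^\alpha x_2^{1-\alpha}\ge|z|\}$. A power cone optimization problem is one with linear constraints and membership constraints in cones $\mathbb{K}_\alpha$. The problem $\mathrm{P}(\mathcal{A})$: find $d^{\vec{i}}_j\in\mathbb{R}$ ($\vec{i}\in\mathscr{D}_n^m$,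 $j\in\vec{i}$) and $v^{\vec{i}}_l\in\mathbb{R}_+$ ($\vec{i}\in\mathscr{D}_n^m$, $1\le l\le m-2$) such that $a_{jj\dots j}\ge\sum_{\vec{i}\in\mathscr{D}_n^m: j\in\vec{i}}d^{\vec{i}}_j$ for all $j\in[n]$, and for all $\vec{i}\in\mathscr{D}_n^m$: $(d^{\vec{i}}_{i_1},v^{\vec{i}}_1,c(\vec{i})^{1/m}a_{\vec{i}})\in\mathbb{K}_{1/m}$; $(d^{\vec{i}}_{i_l},v^{\vec{i}}_l,v^{\vec{i}}_{l-1})\in\mathbb{K}_{1/(m-l+1)}$ for $l=2,\dots,m-2$; $(d^{\vec{i}}_{i_{m-1}},d^{\vec{i}}_{i_m},v^{\vec{i}}_{m-2})\in\mathbb{K}_{1/2}$. For $m=2$ there are no variables $v$ and the cone constraints are just $(d^{\vec{i}}_{i_1},d^{\vec{i}}_{i_2},c(\vec{i})^{1/2}a_{\vec{i}})\in\mathbb{K}_{1/2}$. *)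

theory Defs
  imports
    "HOL-Analysis.Analysis"
    "HOL-Library.Multiset"
    "HOL-Computational_Algebra.Polynomial"
begin

section \<open>Tensors\<close>

text \<open>
  A real tensor of order \<open>m\<close> and dimension \<open>n\<close> is a function on index lists, of which only
  the values on \<open>tensor_idx m n\<close> matter.
\<close>

type_synonym tensor = "nat list \<Rightarrow> real"

definition tensor_idx :: "nat \<Rightarrow> nat \<Rightarrow> nat list set" where
  "tensor_idx m n = {i. length i = m \<and> set i \<subseteq> {1..n}}"

definition symmetric_tensor :: "nat \<Rightarrow> nat \<Rightarrow> tensor \<Rightarrow> bool" where
  "symmetric_tensor m n A \<longleftrightarrow> (\<forall>i\<in>tensor_idx m n. \<forall>j. mset j = mset i \<longrightarrow> A j = A i)"

definition diag_idx :: "nat list \<Rightarrow> bool" where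
  "diag_idx i \<longleftrightarrow> (\<exists>j. i = replicate (length i) j)"

definition unit_tensor :: tensor where
  "unit_tensor i = (if diag_idx i then 1 else 0)"

definition tensor_eigenvalue :: "nat \<Rightarrow> nat \<Rightarrow> tensor \<Rightarrow> complex \<Rightarrow> bool" where
  "tensor_eigenvalue m n A \<mu> \<longleftrightarrow>
     (\<exists>x :: nat \<Rightarrow> complex. (\<exists>i\<in>{1..n}. x i \<noteq> 0) \<and>
        (\<forall>i\<in>{1..n}. (\<Sum>js\<in>tensor_idx (m - 1) n. complex_of_real (A (i # js)) * prod_list (map x js))
                      = \<mu> * x i ^ (m - 1)))"

definition tensor_rho :: "nat \<Rightarrow> nat \<Rightarrow> tensor \<Rightarrow> real" where
  "tensor_rho m n A = Sup (cmod ` {\<mu>. tensor_eigenvalue m n A \<mu>})"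

definition Z_splitting :: "nat \<Rightarrow> nat \<Rightarrow> tensor \<Rightarrow> real \<Rightarrow> tensor \<Rightarrow> bool" where
  "Z_splitting m n A s D \<longleftrightarrow> s \<ge> 0 \<and> (\<forall>i\<in>tensor_idx m n. D i \<ge> 0) \<and>
     (\<forall>i\<in>tensor_idx m n. A i = s * unit_tensor i - D i)"

definition M_tensor :: "nat \<Rightarrow> nat \<Rightarrow> tensor \<Rightarrow> bool" where
  "M_tensor m n A \<longleftrightarrow> (\<exists>s D. Z_splitting m n A s D \<and> s \<ge> tensor_rho m n D)"

definition comparison_tensor :: "tensor \<Rightarrow> tensor" where
  "comparison_tensor A i = (if diag_idx i then \<bar>A i\<bar> else - \<bar>A i\<bar>)"

definition H_tensor :: "nat \<Rightarrow> nat \<Rightarrow> tensor \<Rightarrow> bool" where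
  "H_tensor m n A \<longleftrightarrow> M_tensor m n (comparison_tensor A)"

definition nonneg_diag :: "nat \<Rightarrow> nat \<Rightarrow> tensor \<Rightarrow> bool" where
  "nonneg_diag m n A \<longleftrightarrow> (\<forall>j\<in>{1..n}. A (replicate m j) \<ge> 0)"

definition Hplus_tensor :: "nat \<Rightarrow> nat \<Rightarrow> tensor \<Rightarrow> bool" where
  "Hplus_tensor m n A \<longleftrightarrow> H_tensor m n A \<and> nonneg_diag m n A"

definition DD_tensor :: "nat \<Rightarrow> nat \<Rightarrow> tensor \<Rightarrow> bool" where
  "DD_tensor m n A \<longleftrightarrow>
     (\<forall>i\<in>{1..n}. \<bar>A (replicate m i)\<bar> \<ge>
        (\<Sum>js\<in>tensor_idx (m - 1) n - {replicate (m - 1) i}. \<bar>A (i # js)\<bar>))"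

definition GDD_tensor :: "nat \<Rightarrow> nat \<Rightarrow> tensor \<Rightarrow> bool" where
  "GDD_tensor m n A \<longleftrightarrow>
     (\<exists>d :: nat \<Rightarrow> real. (\<forall>i\<in>{1..n}. d i > 0) \<and>
        DD_tensor m n (\<lambda>i. A i * d (hd i) powi (1 - int m) * prod_list (map d (tl i))))"

definition GDDplus_tensor :: "nat \<Rightarrow> nat \<Rightarrow> tensor \<Rightarrow> bool" where
  "GDDplus_tensor m n A \<longleftrightarrow> GDD_tensor m n A \<and> nonneg_diag m n A"


section \<open>Power cone optimization problems\<close>

text \<open>
  The case \<open>a = 0\<close> is separated only because \<open>0 powr 0 = 0\<close> in the library, whereas the power cones
  with parameters \<open>0\<close> and \<open>1\<close> presuppose the convention that \<open>0\<close> to the power \<open>0\<close> is \<open>1\<close>.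
\<close>

definition cone_pow :: "real \<Rightarrow> real \<Rightarrow> real" where
  "cone_pow x a = (if a = 0 then 1 else x powr a)"

definition power_cone :: "real \<Rightarrow> (real \<times> real \<times> real) set" where
  "power_cone \<alpha> = {(x1, x2, z). x1 \<ge> 0 \<and> x2 \<ge> 0 \<and> cone_pow x1 \<alpha> * cone_pow x2 (1 - \<alpha>) \<ge> \<bar>z\<bar>}"

text \<open>
  An affine expression consists of its coefficients and its constant term. It is evaluated over the
  finite set of variables of the problem in which it occurs.
\<close>

type_synonym 'v affine = "('v \<Rightarrow> real) \<times> real"

definition aff_var :: "'v \<Rightarrow> 'v affine" where
  "aff_var v = ((\<lambda>w. if w = v then 1 else 0), 0)"

definition aff_const :: "real \<Rightarrow> 'v affine" where
  "aff_const b = ((\<lambda>_. 0), b)"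

definition aff_eval :: "'v set \<Rightarrow> ('v \<Rightarrow> real) \<Rightarrow> 'v affine \<Rightarrow> real" where
  "aff_eval V x e = (\<Sum>v\<in>V. fst e v * x v) + snd e"

text \<open>
  A feasibility problem (zero objective): each \<open>e\<close> in \<open>pc_lins\<close> stands for the linear inequality
  \<open>e \<ge> 0\<close>, each \<open>(\<alpha>, e1, e2, e3)\<close> in \<open>pc_cones\<close> for the membership of \<open>(e1, e2, e3)\<close> in \<open>power_cone \<alpha>\<close>.
\<close>

record 'v pc_problem =
  pc_vars :: "'v set"
  pc_lins :: "'v affine set"
  pc_cones :: "(real \<times> 'v affine \<times> 'v affine \<times> 'v affine) set"

definition affine_over :: "'v set \<Rightarrow> 'v affine \<Rightarrow> bool" where
  "affine_over V e \<longleftrightarrow> (\<forall>v. fst e v \<noteq> 0 \<longrightarrow> v \<in> V)"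

definition power_cone_problem :: "('v, 'z) pc_problem_scheme \<Rightarrow> bool" where
  "power_cone_problem P \<longleftrightarrow>
     finite (pc_vars P) \<and> finite (pc_lins P) \<and> finite (pc_cones P) \<and>
     (\<forall>e\<in>pc_lins P. affine_over (pc_vars P) e) \<and>
     (\<forall>(\<alpha>, e1, e2, e3)\<in>pc_cones P. 0 \<le> \<alpha> \<and> \<alpha> \<le> 1 \<and>
        affine_over (pc_vars P) e1 \<and> affine_over (pc_vars P) e2 \<and> affine_over (pc_vars P) e3)"

definition pc_feasible :: "('v, 'z) pc_problem_scheme \<Rightarrow> bool" where
  "pc_feasible P \<longleftrightarrow>
     (\<exists>x. (\<forall>e\<in>pc_lins P. aff_eval (pc_vars P) x e \<ge> 0) \<and>
          (\<forall>(\<alpha>, e1, e2, e3)\<in>pc_cones P.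
             (aff_eval (pc_vars P) x e1, aff_eval (pc_vars P) x e2, aff_eval (pc_vars P) x e3)
               \<in> power_cone \<alpha>))"


section \<open>The power cone problem of a tensor\<close>

definition offdiag_idx :: "nat \<Rightarrow> nat \<Rightarrow> nat list set" where
  "offdiag_idx m n = {i \<in> tensor_idx m n. sorted i \<and> \<not> diag_idx i}"

definition multinom :: "nat \<Rightarrow> nat set \<Rightarrow> (nat \<Rightarrow> nat) \<Rightarrow> real" where
  "multinom N S \<beta> = fact N / (\<Prod>j\<in>S. fact (\<beta> j))"

definition c_idx :: "nat list \<Rightarrow> real" where
  "c_idx i = (\<Prod>k\<in>set i.
     multinom (length i - 1) (set i) (\<lambda>j. count_list i j - (if j = k then 1 else 0)) ^ count_list i k)"

datatype pvar = DVar "nat list" nat | VVar "nat list" nat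

definition P_vars :: "nat \<Rightarrow> nat \<Rightarrow> pvar set" where
  "P_vars m n = {DVar i j | i j. i \<in> offdiag_idx m n \<and> j \<in> set i} \<union>
                {VVar i l | i l. i \<in> offdiag_idx m n \<and> l \<in> {1..m - 2}}"

definition P_row :: "nat \<Rightarrow> nat \<Rightarrow> tensor \<Rightarrow> nat \<Rightarrow> pvar affine" where
  "P_row m n A j =
     ((\<lambda>w. if \<exists>i\<in>offdiag_idx m n. j \<in> set i \<and> w = DVar i j then -1 else 0), A (replicate m j))"

definition P_lins :: "nat \<Rightarrow> nat \<Rightarrow> tensor \<Rightarrow> pvar affine set" where
  "P_lins m n A = P_row m n A ` {1..n} \<union>
                  {aff_var (VVar i l) | i l. i \<in> offdiag_idx m n \<and> l \<in> {1..m - 2}}"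

text \<open>List positions start at \<open>0\<close>, so the \<open>l\<close>-th component of the index \<open>i\<close> is \<open>i ! (l - 1)\<close>.\<close>

definition P_idx_cones ::
    "nat \<Rightarrow> tensor \<Rightarrow> nat list \<Rightarrow> (real \<times> pvar affine \<times> pvar affine \<times> pvar affine) set" where
  "P_idx_cones m A i =
     (let D = (\<lambda>l. aff_var (DVar i (i ! (l - 1))));
          V = (\<lambda>l. aff_var (VVar i l));
          a = aff_const (root m (c_idx i) * A i)
      in if m = 2 then {(1/2, D 1, D 2, a)}
         else {(1 / real m, D 1, V 1, a)} \<union>
              {(1 / real (m - l + 1), D l, V l, V (l - 1)) | l. l \<in> {2..m - 2}} \<union>
              {(1/2, D (m - 1), D m, V (m - 2))})"

text \<open>
  The constraints of the problem are pairwise different (if \<open>n \<ge> 2\<close>, every row in \<open>P_lins\<close> has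
  variables of its own), so nothing is lost by collecting them in sets and counting by \<open>card\<close>.
\<close>

definition P_problem :: "nat \<Rightarrow> nat \<Rightarrow> tensor \<Rightarrow> pvar pc_problem" where
  "P_problem m n A =
     \<lparr>pc_vars = P_vars m n,
      pc_lins = P_lins m n A,
      pc_cones = (\<Union>i\<in>offdiag_idx m n. P_idx_cones m A i)\<rparr>"


subsection \<open>The problem in terms of its variables\<close>

lemma finite_tensor_idx: "finite (tensor_idx m n)"
  using finite_lists_length_eq[of "{1..n}" m] by (simp add: tensor_idx_def conj_commute)

lemma finite_offdiag_idx: "finite (offdiag_idx m n)"
  using finite_tensor_idx by (simp add: offdiag_idx_def)

lemma finite_P_vars: "finite (P_vars m n)"
proof -
  have "P_vars m n = (\<Union>i\<in>offdiag_idx m n. DVar i ` set i) \<union>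
                     (\<Union>i\<in>offdiag_idx m n. VVar i ` {1..m - 2})"
    by (auto simp: P_vars_def)
  then show ?thesis using finite_offdiag_idx by auto
qed

lemma aff_eval_var: "finite V \<Longrightarrow> v \<in> V \<Longrightarrow> aff_eval V x (aff_var v) = x v"
  by (simp add: aff_eval_def aff_var_def if_distrib[of "\<lambda>c. c * _"] cong: if_cong)

lemma aff_eval_const: "aff_eval V x (aff_const b) = b"
  by (simp add: aff_eval_def aff_const_def)

lemma aff_eval_row:
  "aff_eval (P_vars m n) x (P_row m n A j) =
     A (replicate m j) - (\<Sum>i | i \<in> offdiag_idx m n \<and> j \<in> set i. x (DVar i j))"
proof -
  let ?S = "{i \<in> offdiag_idx m n. j \<in> set i}"
  have "(\<Sum>v\<in>P_vars m n. fst (P_row m n A j) v * x v) = (\<Sum>v\<in>(\<lambda>i. DVar i j) ` ?S. - x v)"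
    using finite_P_vars
    by (intro sum.mono_neutral_cong_right) (auto simp: P_row_def P_vars_def)
  also have "\<dots> = - (\<Sum>i\<in>?S. x (DVar i j))"
    by (subst sum.reindex) (auto simp: inj_on_def sum_negf)
  finally show ?thesis by (simp add: aff_eval_def P_row_def)
qed

lemma pc_feasible_P_problem:
  assumes "m \<ge> 2"
  shows "pc_feasible (P_problem m n A) \<longleftrightarrow>
    (\<exists>(d :: nat list \<Rightarrow> nat \<Rightarrow> real) (v :: nat list \<Rightarrow> nat \<Rightarrow> real).
       (\<forall>i\<in>offdiag_idx m n. \<forall>l\<in>{1..m - 2}. v i l \<ge> 0) \<and>
       (\<forall>j\<in>{1..n}. A (replicate m j) \<ge> (\<Sum>i | i \<in> offdiag_idx m n \<and> j \<in> set i. d i j)) \<and>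
       (\<forall>i\<in>offdiag_idx m n.
          if m = 2 then (d i (i ! 0), d i (i ! 1), root m (c_idx i) * A i) \<in> power_cone (1/2)
          else (d i (i ! 0), v i 1, root m (c_idx i) * A i) \<in> power_cone (1 / real m) \<and>
               (\<forall>l\<in>{2..m - 2}. (d i (i ! (l - 1)), v i l, v i (l - 1))
                                  \<in> power_cone (1 / real (m - l + 1))) \<and>
               (d i (i ! (m - 2)), d i (i ! (m - 1)), v i (m - 2)) \<in> power_cone (1/2)))"
    (is "_ \<longleftrightarrow> (\<exists>d v. ?F d v)")
proof -
  define feas where "feas x \<longleftrightarrow>
     (\<forall>e\<in>pc_lins (P_problem m n A). aff_eval (P_vars m n) x e \<ge> 0) \<and>
     (\<forall>(\<alpha>, e1, e2, e3)\<in>pc_cones (P_problem m n A).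
        (aff_eval (P_vars m n) x e1, aff_eval (P_vars m n) x e2, aff_eval (P_vars m n) x e3)
          \<in> power_cone \<alpha>)" for x
  have eD: "aff_eval (P_vars m n) x (aff_var (DVar i (i ! k))) = x (DVar i (i ! k))"
    if "i \<in> offdiag_idx m n" "k < m" for x i k
    using that by (intro aff_eval_var finite_P_vars)
      (auto simp: P_vars_def offdiag_idx_def tensor_idx_def)
  have eV: "aff_eval (P_vars m n) x (aff_var (VVar i l)) = x (VVar i l)"
    if "i \<in> offdiag_idx m n" "1 \<le> l" "l \<le> m - 2" for x i l
    using that by (intro aff_eval_var finite_P_vars) (auto simp: P_vars_def)
  have lins: "(\<forall>e\<in>pc_lins (P_problem m n A). aff_eval (P_vars m n) x e \<ge> 0) \<longleftrightarrow>
      (\<forall>i\<in>offdiag_idx m n. \<forall>l\<in>{1..m - 2}. x (VVar i l) \<ge> 0) \<and>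
      (\<forall>j\<in>{1..n}. A (replicate m j) \<ge>
         (\<Sum>i | i \<in> offdiag_idx m n \<and> j \<in> set i. x (DVar i j)))" for x
  proof -
    have "(\<forall>e\<in>pc_lins (P_problem m n A). aff_eval (P_vars m n) x e \<ge> 0) \<longleftrightarrow>
      (\<forall>i\<in>offdiag_idx m n. \<forall>l\<in>{1..m - 2}. aff_eval (P_vars m n) x (aff_var (VVar i l)) \<ge> 0) \<and>
      (\<forall>j\<in>{1..n}. aff_eval (P_vars m n) x (P_row m n A j) \<ge> 0)"
    proof -
      have "pc_lins (P_problem m n A) =
          (\<Union>i\<in>offdiag_idx m n. (\<lambda>l. aff_var (VVar i l)) ` {1..m - 2}) \<union> P_row m n A ` {1..n}"
        unfolding P_problem_def P_lins_def pc_problem.select_convs by blast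
      then show ?thesis by (simp only: ball_Un ball_UN ball_simps)
    qed
    then show ?thesis by (simp add: aff_eval_row eV)
  qed
  have cone: "(\<forall>(\<alpha>, e1, e2, e3)\<in>P_idx_cones m A i.
        (aff_eval (P_vars m n) x e1, aff_eval (P_vars m n) x e2, aff_eval (P_vars m n) x e3)
          \<in> power_cone \<alpha>) \<longleftrightarrow>
      (if m = 2 then (x (DVar i (i ! 0)), x (DVar i (i ! 1)), root m (c_idx i) * A i) \<in> power_cone (1/2)
       else (x (DVar i (i ! 0)), x (VVar i 1), root m (c_idx i) * A i) \<in> power_cone (1 / real m) \<and>
            (\<forall>l\<in>{2..m - 2}. (x (DVar i (i ! (l - 1))), x (VVar i l), x (VVar i (l - 1)))
                               \<in> power_cone (1 / real (m - l + 1))) \<and>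
            (x (DVar i (i ! (m - 2))), x (DVar i (i ! (m - 1))), x (VVar i (m - 2)))
               \<in> power_cone (1/2))"
    if i: "i \<in> offdiag_idx m n" for x i
  proof (cases "m = 2")
    case True
    then show ?thesis
      using eD[OF i, of 0] eD[OF i, of 1] by (simp add: P_idx_cones_def aff_eval_const)
  next
    case False
    define E where "E = aff_eval (P_vars m n) x"
    have "(\<forall>(\<alpha>, e1, e2, e3)\<in>P_idx_cones m A i. (E e1, E e2, E e3) \<in> power_cone \<alpha>) \<longleftrightarrow>
      (E (aff_var (DVar i (i ! 0))), E (aff_var (VVar i 1)), E (aff_const (root m (c_idx i) * A i)))
         \<in> power_cone (1 / real m) \<and>
      (\<forall>l\<in>{2..m - 2}. (E (aff_var (DVar i (i ! (l - 1)))), E (aff_var (VVar i l)),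
                        E (aff_var (VVar i (l - 1)))) \<in> power_cone (1 / real (m - l + 1))) \<and>
      (E (aff_var (DVar i (i ! (m - 2)))), E (aff_var (DVar i (i ! (m - 1)))),
         E (aff_var (VVar i (m - 2)))) \<in> power_cone (1/2)"
    proof -
      have "P_idx_cones m A i =
        {(1 / real m, aff_var (DVar i (i ! 0)), aff_var (VVar i 1),
           aff_const (root m (c_idx i) * A i))} \<union>
        (\<lambda>l. (1 / real (m - l + 1), aff_var (DVar i (i ! (l - 1))), aff_var (VVar i l),
           aff_var (VVar i (l - 1)))) ` {2..m - 2} \<union>
        {(1/2, aff_var (DVar i (i ! (m - 2))), aff_var (DVar i (i ! (m - 1))),
           aff_var (VVar i (m - 2)))}"
        using False unfolding P_idx_cones_def Let_def Setcompr_eq_image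
        by (simp only: if_False diff_diff_eq diff_self_eq_0 one_add_one)
      then show ?thesis by (simp only: ball_Un) simp
    qed
    moreover have "(\<forall>l\<in>{2..m - 2}. (E (aff_var (DVar i (i ! (l - 1)))), E (aff_var (VVar i l)),
                        E (aff_var (VVar i (l - 1)))) \<in> power_cone (1 / real (m - l + 1))) \<longleftrightarrow>
       (\<forall>l\<in>{2..m - 2}. (x (DVar i (i ! (l - 1))), x (VVar i l), x (VVar i (l - 1)))
                               \<in> power_cone (1 / real (m - l + 1)))"
      unfolding E_def by (intro ball_cong refl) (use eD[OF i] eV[OF i] in auto)
    ultimately show ?thesis
      using False assms eD[OF i, of 0] eD[OF i, of "m - 1"] eD[OF i, of "m - 2"]
        eV[OF i, of 1] eV[OF i, of "m - 2"]
      by (simp add: E_def aff_eval_const)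
  qed
  have feas: "feas x \<longleftrightarrow> ?F (\<lambda>i j. x (DVar i j)) (\<lambda>i l. x (VVar i l))" for x
  proof -
    have "feas x \<longleftrightarrow> (\<forall>e\<in>pc_lins (P_problem m n A). aff_eval (P_vars m n) x e \<ge> 0) \<and>
        (\<forall>i\<in>offdiag_idx m n. \<forall>(\<alpha>, e1, e2, e3)\<in>P_idx_cones m A i.
          (aff_eval (P_vars m n) x e1, aff_eval (P_vars m n) x e2, aff_eval (P_vars m n) x e3)
            \<in> power_cone \<alpha>)"
      unfolding feas_def by (simp add: P_problem_def)
    then show ?thesis using cone lins by simp
  qed
  have "pc_feasible (P_problem m n A) \<longleftrightarrow> (\<exists>x. feas x)"
    by (simp add: pc_feasible_def feas_def P_problem_def)
  also have "\<dots> \<longleftrightarrow> (\<exists>d v. ?F d v)"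
  proof
    assume "\<exists>x. feas x"
    then obtain x where "feas x" by blast
    then have "?F (\<lambda>i j. x (DVar i j)) (\<lambda>i l. x (VVar i l))" by (simp only: feas)
    then show "\<exists>d v. ?F d v"
      by (rule exI[of _ "\<lambda>i j. x (DVar i j)", OF exI[of _ "\<lambda>i l. x (VVar i l)"]])
  next
    assume "\<exists>d v. ?F d v"
    then obtain d v where F: "?F d v" by (elim exE)
    have "feas (\<lambda>w. case w of DVar i j \<Rightarrow> d i j | VVar i l \<Rightarrow> v i l)"
      unfolding feas pvar.case by (fact F)
    then show "\<exists>x. feas x" by blast
  qed
  finally show ?thesis .
qed

end

theory Submission
  imports Defs "HOL-Combinatorics.Multiset_Permutations"
begin

text \<open>
  Let \<open>M(A)\<close> be the comparison tensor of \<open>A\<close>. All the properties in question are compared with one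
  condition, the copositivity of \<open>M(A)\<close>: the form \<open>\<Sum> M(A)\<^sub>i x\<^sub>i\<close> is nonnegative on the
  nonnegative orthant. For a symmetric tensor \<open>A\<close> the \<open>H\<close>-tensor property, copositivity of \<open>M(A)\<close>
  and generalized diagonal dominance are equivalent, and feasibility of the power cone problem fits
  in once the diagonal is nonnegative.

  From \<open>H\<close>-tensors to copositivity (\<open>H_tensor_imp_copositive\<close>): write \<open>M(A) = s I - D\<close> and maximize
  the form of \<open>D\<close> over nonnegative vectors with \<open>\<Sum> x\<^sub>j\<^sup>m = 1\<close>. By symmetry a maximizer is
  an eigenvector whose eigenvalue is the maximum, so the maximum is at most \<open>\<rho>(D) \<le> s\<close>.

  From copositivity to dominance (\<open>copositive_imp_scaled_dominance\<close>): a maximizer of the negated form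
  of \<open>M(A)\<close> satisfies the dominance inequalities on its support. The maximizer need not be positive,
  but no nonzero entry of the tensor couples its support with the complement
  (\<open>maximizer_support_closed\<close>), so the argument can be repeated on the complement. This decoupling
  is what makes the scaling strictly positive. From dominance back to
  \<open>H\<close>-tensors the scaling bounds the modulus of all eigenvalues.

  The power cone problem replaces the scaling by shares \<open>d\<close> of the diagonal. Each tower of cones
  says that a product of shares is at least \<open>c(i) \<bar>a\<^sub>i\<bar>\<^sup>m\<close> (\<open>ex_cone_tower_iff\<close>). A scaling provides
  such shares with equality; conversely such shares give copositivity by the arithmetic-geometric mean
  inequality, monomial by monomial. The scaling is then recovered from copositivity.

  Rows of the tensor are indexed by arbitrary lists, the power cone problem by sorted ones; the two
  are linked by counting rearrangements (\<open>row_sum_eq_sorted_sum\<close>).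
\<close>

section \<open>Monomials given by index lists\<close>

lemma continuous_on_prod_list_map:
  fixes f :: "'a::topological_space \<Rightarrow> 'b \<Rightarrow> real"
  assumes "\<And>j. continuous_on S (\<lambda>x. f x j)"
  shows "continuous_on S (\<lambda>x. prod_list (map (f x) i))"
  by (induction i) (auto intro!: continuous_intros assms)

lemma prod_list_map_scale:
  fixes x :: "'a \<Rightarrow> real"
  shows "prod_list (map (\<lambda>j. c * x j) i) = c ^ length i * prod_list (map x i)"
  by (induction i) auto

lemma prod_list_map_fun_upd_scale:
  fixes x :: "'a \<Rightarrow> real"
  shows "prod_list (map (x(k := t * x k)) i) = t ^ count_list i k * prod_list (map x i)"
  by (induction i) auto

lemma prod_list_map_nonneg:
  fixes x :: "'a \<Rightarrow> real"
  assumes "\<And>j. j \<in> set i \<Longrightarrow> x j \<ge> 0"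
  shows "prod_list (map x i) \<ge> 0"
  using assms by (induction i) auto

lemma prod_list_map_pos:
  fixes x :: "'a \<Rightarrow> real"
  assumes "\<And>j. j \<in> set i \<Longrightarrow> x j > 0"
  shows "prod_list (map x i) > 0"
  using assms by (induction i) auto

lemma prod_list_map_mono:
  fixes x :: "'a \<Rightarrow> real"
  assumes "\<And>j. j \<in> set i \<Longrightarrow> 0 \<le> x j" "\<And>j. j \<in> set i \<Longrightarrow> x j \<le> y j"
  shows "prod_list (map x i) \<le> prod_list (map y i)"
  using assms
proof (induction i)
  case (Cons a i)
  then show ?case by (auto intro!: mult_mono prod_list_map_nonneg intro: order_trans)
qed simp

lemma prod_list_map_eq_0:
  fixes x :: "'a \<Rightarrow> real"
  assumes "j \<in> set i" "x j = 0"
  shows "prod_list (map x i) = 0"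
  using assms by (induction i) auto

lemma prod_list_map_split:
  fixes x :: "'a \<Rightarrow> real"
  shows "prod_list (map (\<lambda>j. if j \<in> S then x j else e) i) =
    prod_list (map x (filter (\<lambda>j. j \<in> S) i)) * e ^ length (filter (\<lambda>j. j \<notin> S) i)"
  by (induction i) auto

section \<open>Maximizers of homogeneous forms\<close>

text \<open>
  The form has arbitrary coefficients on the pure powers and nonnegative ones on all other
  monomials. Two instances matter: the form of the nonnegative tensor \<open>D\<close> of a splitting
  \<open>s I - D\<close>, whose maximizer becomes an eigenvector of \<open>D\<close>, and the negative of the form of a
  comparison tensor, whose maximizer becomes a diagonal scaling.
\<close>

locale dominated_form =
  fixes m :: nat and C :: "'a set" and b :: "'a \<Rightarrow> real"
    and E :: "'a list set" and w :: "'a list \<Rightarrow> real"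
  assumes m: "m \<ge> 2" and C: "finite C" "C \<noteq> {}" and E: "finite E"
    and idx: "\<And>i. i \<in> E \<Longrightarrow> length i = m \<and> set i \<subseteq> C"
    and w: "\<And>i. i \<in> E \<Longrightarrow> w i \<ge> 0"
begin

definition form :: "('a \<Rightarrow> real) \<Rightarrow> real" where
  "form x = (\<Sum>j\<in>C. b j * x j ^ m) + (\<Sum>i\<in>E. w i * prod_list (map x i))"

lemma form_scale: "form (\<lambda>j. c * x j) = c ^ m * form x"
proof -
  have "(\<Sum>i\<in>E. w i * prod_list (map (\<lambda>j. c * x j) i)) = (\<Sum>i\<in>E. c ^ m * (w i * prod_list (map x i)))"
    using idx by (intro sum.cong) (auto simp: prod_list_map_scale)
  then show ?thesis
    by (simp add: form_def power_mult_distrib sum_distrib_left algebra_simps)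
qed

lemma form_restrict: "form (\<lambda>j. if j \<in> C then x j else 0) = form x"
proof -
  have "map (\<lambda>j. if j \<in> C then x j else 0) i = map x i" if "i \<in> E" for i
    using idx[OF that] by auto
  then have "(\<Sum>i\<in>E. w i * prod_list (map (\<lambda>j. if j \<in> C then x j else 0) i)) =
      (\<Sum>i\<in>E. w i * prod_list (map x i))"
    by (intro sum.cong) metis+
  then show ?thesis by (simp add: form_def)
qed

text \<open>
  The nonnegative part of the unit sphere of the \<open>m\<close>-norm is compact, so the form attains its
  maximum there. Homogeneity turns the maximum into an inequality on the whole orthant.
\<close>

lemma maximizer_exists:
  obtains x where "\<And>j. x j \<ge> 0" "\<And>j. j \<notin> C \<Longrightarrow> x j = 0" "(\<Sum>j\<in>C. x j ^ m) = 1"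
    "\<forall>y. (\<forall>j. y j \<ge> 0) \<longrightarrow> form y \<le> form x * (\<Sum>j\<in>C. y j ^ m)"
proof -
  define B where "B = Pi\<^sub>E UNIV (\<lambda>j. if j \<in> C then {0..1::real} else {0})"
  define K where "K = B \<inter> {x. (\<Sum>j\<in>C. x j ^ m) = 1}"
  have coord: "continuous_on S (\<lambda>x::'a \<Rightarrow> real. x j)" for S j
    by (rule continuous_on_subset[OF continuous_on_product_coordinates]) simp
  have "compactin euclidean B"
    unfolding B_def euclidean_product_topology[symmetric] compactin_PiE by auto
  \<comment> \<open>A product of compact intervals, by Tychonoff's theorem.\<close>
  then have "compact B" by simp
  moreover have "closed {x::'a \<Rightarrow> real. (\<Sum>j\<in>C. x j ^ m) = 1}"
    by (intro closed_Collect_eq continuous_intros coord)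
  ultimately have K: "compact K" unfolding K_def by (rule compact_Int_closed)
  have form: "continuous_on K form"
    unfolding form_def by (intro continuous_intros coord continuous_on_prod_list_map)
  obtain c where c: "c \<in> C" using C by auto
  have "(\<lambda>j. if j = c then 1 else 0) \<in> K"
    using c C m by (auto simp: K_def B_def if_distrib[of "\<lambda>t. t ^ m"] power_0_left
      split: if_splits cong: if_cong)
  then have "K \<noteq> {}" by auto
  from continuous_attains_sup[OF K this form] obtain x
    where x: "x \<in> K" and max: "\<And>y. y \<in> K \<Longrightarrow> form y \<le> form x" by auto
  have xC: "x j \<in> (if j \<in> C then {0..1} else {0})" for j
    using x PiE_mem[of x UNIV _ j] unfolding K_def B_def by blast
  show ?thesis
  proof (rule that)
    show "x j \<ge> 0" for j using xC[of j] by (auto split: if_splits)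
    show "x j = 0" if "j \<notin> C" for j using xC[of j] that by auto
    show "(\<Sum>j\<in>C. x j ^ m) = 1" using x by (simp add: K_def)
    have "form y \<le> form x * (\<Sum>j\<in>C. y j ^ m)" if y: "\<And>j. y j \<ge> 0" for y
    proof -
      define N where "N = (\<Sum>j\<in>C. y j ^ m)"
      have N0: "N \<ge> 0" unfolding N_def using y by (intro sum_nonneg) auto
      have yN: "y j ^ m \<le> N" if "j \<in> C" for j
        unfolding N_def using that C y by (intro member_le_sum) auto
      show ?thesis
      proof (cases "N = 0")
        case True
        have "y j = 0" if "j \<in> C" for j using yN[OF that] True y[of j] by (auto simp: power_le_zero_eq)
        moreover have "prod_list (map y i) = 0" if "i \<in> E" for i
        proof -
          have "hd i \<in> set i" using idx[OF that] m by (cases i) auto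
          with idx[OF that] show ?thesis using calculation by (intro prod_list_map_eq_0[of "hd i"]) auto
        qed
        ultimately show ?thesis using m by (simp add: form_def power_0_left)
      next
        case False
        define r where "r = root m N"
        have r: "r > 0" "r ^ m = N" using N0 False m by (auto simp: r_def)
        define z where "z = (\<lambda>j. if j \<in> C then (1 / r) * y j else 0)"
        have "(\<Sum>j\<in>C. z j ^ m) = (\<Sum>j\<in>C. y j ^ m / N)"
          by (intro sum.cong) (auto simp: z_def power_divide r)
        also have "\<dots> = 1" using False by (simp add: N_def flip: sum_divide_distrib)
        finally have z1: "(\<Sum>j\<in>C. z j ^ m) = 1" .
        have "z j \<in> {0..1}" if "j \<in> C" for j
        proof -
          have "z j \<ge> 0" using that y r by (auto simp: z_def)
          moreover have "z j ^ m \<le> 1" using that yN[OF that] r False N0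
            by (auto simp: z_def power_divide)
          ultimately show ?thesis using m by (auto simp: power_le_one_iff)
        qed
        then have "z \<in> K" using z1 by (auto simp: K_def B_def z_def)
        then have "form z \<le> form x" by (rule max)
        moreover have "form z = form y / N"
          unfolding z_def form_restrict form_scale using r by (simp add: power_divide)
        ultimately show ?thesis using False N0 by (simp add: N_def[symmetric] divide_le_eq)
      qed
    qed
    then show "\<forall>y. (\<forall>j. y j \<ge> 0) \<longrightarrow> form y \<le> form x * (\<Sum>j\<in>C. y j ^ m)" by blast
  qed
qed

text \<open>
  A maximizer may have zero entries, but they are decoupled from the nonzero ones. Raising all
  zero entries to \<open>e\<close> changes the pure powers only by terms of order \<open>e\<close> to the power \<open>m\<close>,
  whereas a monomial that mixes zero and nonzero entries would gain a positive multiple of \<open>e\<close> to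
  some power below \<open>m\<close>.
\<close>

lemma maximizer_support_closed:
  assumes x: "\<And>j. x j \<ge> 0"
    and max: "form x = l * (\<Sum>j\<in>C. x j ^ m)" "\<And>y. (\<And>j. y j \<ge> 0) \<Longrightarrow> form y \<le> l * (\<Sum>j\<in>C. y j ^ m)"
    and i0: "i0 \<in> E" "j \<in> set i0" "x j \<noteq> 0" "k \<in> set i0" "x k = 0"
  shows "w i0 = 0"
proof (rule ccontr)
  assume "w i0 \<noteq> 0"
  then have w0: "w i0 > 0" using w[OF i0(1)] by simp
  define S where "S = {j. x j \<noteq> 0}"
  define q where "q = prod_list (map x (filter (\<lambda>j. j \<in> S) i0))"
  define Z where "Z = C - S"
  define L where "L = l * card Z - sum b Z"
  have q: "q > 0" unfolding q_def using x by (intro prod_list_map_pos) (auto simp: S_def less_le)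
  have bound: "w i0 * q \<le> L * e" if e: "0 < e" "e \<le> 1" for e
  proof -
    define y where "y = (\<lambda>j. if j \<in> S then x j else e)"
    have xy: "x j \<le> y j" for j using e by (auto simp: y_def S_def)
    have y0: "y j \<ge> 0" for j using x[of j] xy[of j] by linarith
    have split: "sum f C = sum f (C \<inter> S) + sum f Z" for f :: "'a \<Rightarrow> real"
      unfolding Z_def using C by (metis sum.Int_Diff)
    have y_diag: "(\<Sum>j\<in>C. c j * y j ^ m) = (\<Sum>j\<in>C. c j * x j ^ m) + sum c Z * e ^ m" for c
    proof -
      have "(\<Sum>j\<in>C\<inter>S. c j * y j ^ m) = (\<Sum>j\<in>C\<inter>S. c j * x j ^ m)" by (simp add: y_def)
      moreover have "(\<Sum>j\<in>Z. c j * y j ^ m) = sum c Z * e ^ m"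
        by (simp add: y_def Z_def sum_distrib_right)
      moreover have "(\<Sum>j\<in>Z. c j * x j ^ m) = 0"
        using m by (intro sum.neutral) (auto simp: Z_def S_def)
      ultimately show ?thesis by (simp add: split)
    qed
    let ?p = "prod_list (map y i0)"
    define t where "t = length (filter (\<lambda>j. j \<notin> S) i0)"
    have "t + length (filter (\<lambda>j. j \<in> S) i0) = m"
      unfolding t_def using idx[OF i0(1)] sum_length_filter_compl[of "\<lambda>j. j \<in> S" i0] by simp
    moreover have "filter (\<lambda>j. j \<in> S) i0 \<noteq> []" using i0 by (auto simp: filter_empty_conv S_def)
    ultimately have t: "t \<le> m - 1" by (cases "filter (\<lambda>j. j \<in> S) i0") auto
    have "q * e ^ (m - 1) \<le> q * e ^ t" using q e t by (intro mult_left_mono power_decreasing) auto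
    also have "\<dots> = ?p" unfolding y_def prod_list_map_split q_def t_def by simp
    finally have p: "q * e ^ (m - 1) \<le> ?p" .
    have px: "prod_list (map x i0) = 0" using i0 by (intro prod_list_map_eq_0[of k]) auto
    have "(\<Sum>i\<in>E. w i * prod_list (map x i)) + w i0 * ?p
        = (\<Sum>i\<in>E - {i0}. w i * prod_list (map x i)) + w i0 * ?p"
      using E i0 px by (simp add: sum.remove[of E i0])
    also have "\<dots> \<le> (\<Sum>i\<in>E - {i0}. w i * prod_list (map y i)) + w i0 * ?p"
      using w x xy by (intro add_right_mono sum_mono mult_left_mono prod_list_map_mono) auto
    also have "\<dots> = (\<Sum>i\<in>E. w i * prod_list (map y i))"
      using E i0 by (simp add: sum.remove[of E i0])
    finally have "form x + sum b Z * e ^ m + w i0 * ?p \<le> form y"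
      unfolding form_def using y_diag[of b] by simp
    also have "\<dots> \<le> l * (\<Sum>j\<in>C. y j ^ m)" using y0 by (rule max)
    also have "(\<Sum>j\<in>C. y j ^ m) = (\<Sum>j\<in>C. x j ^ m) + card Z * e ^ m" using y_diag[of "\<lambda>_. 1"] by simp
    finally have "w i0 * ?p \<le> L * e ^ m" using max(1) by (simp add: L_def algebra_simps)
    moreover have "w i0 * (q * e ^ (m - 1)) \<le> w i0 * ?p" using p w0 by (intro mult_left_mono) auto
    moreover have "e ^ m = e * e ^ (m - 1)" using m by (metis Suc_diff_1 less_le_trans pos2 power_Suc)
    ultimately have "(w i0 * q) * e ^ (m - 1) \<le> (L * e) * e ^ (m - 1)" by (simp add: algebra_simps)
    then show ?thesis using e by simp
  qed
  have wq: "w i0 * q > 0" using w0 q by simp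
  then have L: "L > 0" using bound[of 1] by simp
  define e where "e = min 1 (w i0 * q / (2 * L))"
  have e: "0 < e" "e \<le> 1" using wq L by (auto simp: e_def)
  have "L * e \<le> L * (w i0 * q / (2 * L))" using L by (intro mult_left_mono) (auto simp: e_def)
  also have "\<dots> = w i0 * q / 2" using L by simp
  finally show False using bound[OF e] wq by simp
qed

text \<open>
  Multiplying the entry \<open>k\<close> by a factor \<open>t\<close> multiplies each monomial by a power of \<open>t\<close>. The
  difference of the two sides of the extremal inequality is a polynomial in \<open>t\<close> with a local
  maximum at \<open>t = 1\<close>, and its derivative there vanishes. For an entry \<open>x k \<noteq> 0\<close> the equation
  divided by \<open>x k\<close> is the Lagrange condition.
\<close>

lemma maximizer_stationary:
  assumes x: "\<And>j. x j \<ge> 0" and k: "k \<in> C"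
    and max: "form x = l * (\<Sum>j\<in>C. x j ^ m)" "\<And>y. (\<And>j. y j \<ge> 0) \<Longrightarrow> form y \<le> l * (\<Sum>j\<in>C. y j ^ m)"
  shows "real m * b k * x k ^ m + (\<Sum>i\<in>E. real (count_list i k) * w i * prod_list (map x i))
    = real m * l * x k ^ m"
proof -
  define y where "y t = x(k := t * x k)" for t
  define G where "G t = form (y t) - l * (\<Sum>j\<in>C. y t j ^ m)" for t
  \<comment> \<open>\<open>R\<close> collects the pure powers that do not depend on \<open>t\<close>.\<close>
  define R where "R = (\<Sum>j\<in>C - {k}. b j * x j ^ m) - l * (\<Sum>j\<in>C - {k}. x j ^ m)"
  have diag: "(\<Sum>j\<in>C. c j * y t j ^ m) = c k * x k ^ m * t ^ m + (\<Sum>j\<in>C - {k}. c j * x j ^ m)" for t and c :: "'a \<Rightarrow> real"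
    using C k by (simp add: sum.remove[of C k] y_def power_mult_distrib)
  have G: "G t = (b k * x k ^ m * t ^ m + (\<Sum>i\<in>E. w i * (t ^ count_list i k * prod_list (map x i)))
      - l * x k ^ m * t ^ m) + R" for t
    unfolding G_def form_def R_def using diag[of b] diag[of "\<lambda>_. 1"]
    by (simp add: y_def prod_list_map_fun_upd_scale algebra_simps)
  have deriv: "(G has_real_derivative
      b k * x k ^ m * (real m * 1 ^ (m - 1)) +
       (\<Sum>i\<in>E. w i * ((real (count_list i k) * 1 ^ (count_list i k - 1)) * prod_list (map x i)))
      - l * x k ^ m * (real m * 1 ^ (m - 1))) (at 1)"
    unfolding G by (auto intro!: derivative_eq_intros DERIV_sum simp: mult_ac)
  have "\<forall>t. \<bar>1 - t\<bar> < 1 \<longrightarrow> G t \<le> G 1"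
  proof (intro allI impI)
    fix t :: real assume "\<bar>1 - t\<bar> < 1"
    then have "y t j \<ge> 0" for j using x[of j] x[of k] by (auto simp: y_def)
    from max(2)[OF this] have "G t \<le> 0" by (simp add: G_def)
    moreover have "G 1 = 0" using max(1) by (simp add: G_def y_def)
    ultimately show "G t \<le> G 1" by simp
  qed
  from DERIV_local_max[OF deriv zero_less_one this] show ?thesis by (simp add: algebra_simps)
qed

end

section \<open>From copositivity to diagonal dominance\<close>

text \<open>
  The maximum of the negated form is at most \<open>0\<close> by copositivity, so on the support of a maximizer
  the stationarity equations say that the maximizer itself is a scaling making the rows dominant.
  No monomial with a nonzero weight mixes the support with its complement. The complement is
  therefore treated separately, by induction, and the two scalings are glued together.
\<close>

lemma copositive_imp_scaled_dominance:
  fixes C :: "'a set" and E :: "'a list set" and a :: "'a \<Rightarrow> real"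
  assumes "m \<ge> 2" "finite C" "finite E"
    and "\<And>i. i \<in> E \<Longrightarrow> length i = m \<and> set i \<subseteq> C"
    and "\<And>i. i \<in> E \<Longrightarrow> w i \<ge> 0"
    and "\<And>x. (\<And>j. x j \<ge> 0) \<Longrightarrow>
           real m * (\<Sum>i\<in>E. w i * prod_list (map x i)) \<le> (\<Sum>j\<in>C. a j * x j ^ m)"
  shows "\<exists>d. (\<forall>j\<in>C. d j > 0) \<and>
    (\<forall>k\<in>C. (\<Sum>i\<in>E. real (count_list i k) * w i * prod_list (map d i)) \<le> a k * d k ^ m)"
  using assms(2-6)
proof (induction "card C" arbitrary: C E rule: less_induct)
  case less
  note C = less.prems(1) and E = less.prems(2) and idx = less.prems(3) and w_nonneg = less.prems(4)
    and cop = less.prems(5)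
  show ?case
  proof (cases "C = {}")
    case False
    interpret dominated_form m C "\<lambda>j. - a j" E "\<lambda>i. real m * w i"
      using assms(1) C False E idx w_nonneg by unfold_locales auto
    obtain x where x: "\<And>j. x j \<ge> 0" "\<And>j. j \<notin> C \<Longrightarrow> x j = 0" "(\<Sum>j\<in>C. x j ^ m) = 1"
      and max: "\<forall>y. (\<forall>j. y j \<ge> 0) \<longrightarrow> form y \<le> form x * (\<Sum>j\<in>C. y j ^ m)"
      using maximizer_exists by blast
    define l where "l = form x"
    have l: "l \<le> 0" using cop[OF x(1)]
      by (simp add: l_def form_def sum_negf sum_distrib_left mult_ac)
    have max': "form x = l * (\<Sum>j\<in>C. x j ^ m)"
      and max: "\<And>y. (\<And>j. y j \<ge> 0) \<Longrightarrow> form y \<le> l * (\<Sum>j\<in>C. y j ^ m)"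
      using x(3) max by (simp_all add: l_def)
    define S where "S = {j\<in>C. x j \<noteq> 0}"
    \<comment> \<open>\<open>S\<close> is the support, and every relevant monomial lives on one side of it.\<close>
    have pure: "set i \<subseteq> S \<or> set i \<subseteq> C - S" if i: "i \<in> E" and wi: "w i \<noteq> 0" for i
    proof (rule ccontr)
      assume "\<not> ?thesis"
      then obtain j k where "j \<in> set i" "x j \<noteq> 0" "k \<in> set i" "x k = 0"
        using idx[OF i] by (auto simp: S_def)
      from maximizer_support_closed[OF x(1) max' max i this] wi show False using m by simp
    qed
    have "S \<noteq> {}"
    proof
      assume "S = {}"
      then have "(\<Sum>j\<in>C. x j ^ m) = 0" using m by (intro sum.neutral) (auto simp: S_def)
      then show False using x(3) by simp
    qed
    then have "C - S \<subset> C" by (auto simp: S_def)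
    then have card: "card (C - S) < card C" using C by (intro psubset_card_mono)
    define E' where "E' = {i\<in>E. set i \<subseteq> C - S}"
    have "real m * (\<Sum>i\<in>E'. w i * prod_list (map y i)) \<le> (\<Sum>j\<in>C - S. a j * y j ^ m)"
      if y: "\<And>j. y j \<ge> 0" for y
    proof -
      \<comment> \<open>Copositivity passes to the complement by extending with zeros.\<close>
      define z where "z = (\<lambda>j. if j \<in> C - S then y j else 0)"
      have z: "z j \<ge> 0" for j using y by (simp add: z_def)
      have "map z i = map y i" if "i \<in> E'" for i using that by (auto simp: z_def E'_def)
      then have "(\<Sum>i\<in>E'. w i * prod_list (map y i)) = (\<Sum>i\<in>E'. w i * prod_list (map z i))"
        by (intro sum.cong) metis+
      also have "\<dots> \<le> (\<Sum>i\<in>E. w i * prod_list (map z i))"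
        using E w_nonneg z by (intro sum_mono2) (auto simp: E'_def intro!: mult_nonneg_nonneg prod_list_map_nonneg)
      finally have "real m * (\<Sum>i\<in>E'. w i * prod_list (map y i))
          \<le> real m * (\<Sum>i\<in>E. w i * prod_list (map z i))" by (intro mult_left_mono) auto
      also have "\<dots> \<le> (\<Sum>j\<in>C. a j * z j ^ m)" using z by (rule cop)
      also have "\<dots> = (\<Sum>j\<in>C - S. a j * y j ^ m)"
        using C m by (intro sum.mono_neutral_cong_right) (auto simp: z_def power_0_left)
      finally show ?thesis .
    qed
    moreover have finE': "finite E'" and idx': "\<And>i. i \<in> E' \<Longrightarrow> length i = m \<and> set i \<subseteq> C - S"
      and w': "\<And>i. i \<in> E' \<Longrightarrow> w i \<ge> 0"
      using E idx w_nonneg by (auto simp: E'_def)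
    ultimately obtain d where d: "\<And>j. j \<in> C - S \<Longrightarrow> d j > 0"
        "\<And>k. k \<in> C - S \<Longrightarrow>
          (\<Sum>i\<in>E'. real (count_list i k) * w i * prod_list (map d i)) \<le> a k * d k ^ m"
      using less.hyps[OF card _ finE' idx' w'] C by blast
    define f where "f = (\<lambda>j. if j \<in> S then x j else d j)"
    have "f j > 0" if "j \<in> C" for j
      using that d(1)[of j] x(1)[of j] by (auto simp: f_def S_def less_le)
    moreover have "(\<Sum>i\<in>E. real (count_list i k) * w i * prod_list (map f i)) \<le> a k * f k ^ m"
      if k: "k \<in> C" for k
    proof (cases "k \<in> S")
      case True
      have "(\<Sum>i\<in>E. real (count_list i k) * w i * prod_list (map f i))
          = (\<Sum>i\<in>E. real (count_list i k) * w i * prod_list (map x i))"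
      proof (intro sum.cong refl)
        fix i assume i: "i \<in> E"
        have "map f i = map x i" if "w i \<noteq> 0" "k \<in> set i"
          using pure[OF i that(1)] that True by (auto simp: f_def)
        then show "real (count_list i k) * w i * prod_list (map f i) =
            real (count_list i k) * w i * prod_list (map x i)"
          by (cases "w i = 0 \<or> k \<notin> set i") (auto simp: count_list_0_iff simp del: map_eq_conv)
      qed
      moreover have "real m * (\<Sum>i\<in>E. real (count_list i k) * w i * prod_list (map x i))
          = real m * (a k * x k ^ m + l * x k ^ m)"
        using maximizer_stationary[OF x(1) k max' max]
        by (simp add: sum_distrib_left algebra_simps)
      then have "(\<Sum>i\<in>E. real (count_list i k) * w i * prod_list (map x i))
          = a k * x k ^ m + l * x k ^ m" using m by simp
      moreover have "l * x k ^ m \<le> 0" using l x(1)[of k] by (intro mult_nonpos_nonneg) auto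
      ultimately show ?thesis using True by (simp add: f_def)
    next
      case False
      have "(\<Sum>i\<in>E. real (count_list i k) * w i * prod_list (map f i))
          = (\<Sum>i\<in>E'. real (count_list i k) * w i * prod_list (map d i))"
      proof (rule sum.mono_neutral_cong_right)
        show "finite E" "E' \<subseteq> E" using E by (auto simp: E'_def)
        show "\<forall>i\<in>E - E'. real (count_list i k) * w i * prod_list (map f i) = 0"
        proof
          fix i assume i: "i \<in> E - E'"
          show "real (count_list i k) * w i * prod_list (map f i) = 0"
          proof (cases "w i = 0")
            case wi: False
            then have "set i \<subseteq> S" using pure[of i] i by (auto simp: E'_def)
            then have "k \<notin> set i" using False by auto
            then show ?thesis by (simp add: count_list_0_iff)
          qed simp
        qed
        fix i assume "i \<in> E'"
        then have "map f i = map d i" by (auto simp: f_def E'_def)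
        then show "real (count_list i k) * w i * prod_list (map f i) =
            real (count_list i k) * w i * prod_list (map d i)" by metis
      qed
      then show ?thesis using d(2)[of k] k False by (simp add: f_def)
    qed
    ultimately show ?thesis by blast
  qed auto
qed

section \<open>Sorted indices and their multiplicities\<close>

text \<open>
  For an index with multiplicities \<open>\<alpha>\<close> and \<open>\<bar>\<alpha>\<bar> = m\<close> this is \<open>(m - 1)! / \<alpha>!\<close>. The multinomial coefficient
  with one factor removed at \<open>k\<close> is this number times \<open>\<alpha> k\<close>, which makes the dependence on \<open>k\<close>
  explicit; summed over \<open>k\<close> these coefficients give \<open>m! / \<alpha>!\<close>.
\<close>

definition idx_weight :: "'a list \<Rightarrow> real" where
  "idx_weight i = fact (length i - 1) / (\<Prod>j\<in>set i. fact (count_list i j))"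

lemma idx_weight_nonneg: "idx_weight i \<ge> 0"
  by (simp add: idx_weight_def prod_nonneg)

lemma multinom_eq_idx_weight:
  assumes "k \<in> set i"
  shows "multinom (length i - 1) (set i) (\<lambda>j. count_list i j - (if j = k then 1 else 0))
    = idx_weight i * real (count_list i k)"
proof -
  have c: "count_list i k > 0" using assms by (metis count_list_0_iff gr0I)
  have "(\<Prod>j\<in>set i. fact (count_list i j)) =
      real (count_list i k) * (\<Prod>j\<in>set i. fact (count_list i j - (if j = k then 1 else 0)))"
    using assms c by (simp add: prod.remove[of "set i" k] fact_reduce)
  then show ?thesis using c by (simp add: multinom_def idx_weight_def)
qed

lemma prod_list_map_eq_prod_count:
  fixes f :: "'a \<Rightarrow> real"
  shows "prod_list (map f i) = (\<Prod>k\<in>set i. f k ^ count_list i k)"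
proof -
  have "prod_list (map f i) = (\<Prod>k\<in>S. f k ^ count_list i k)" if "finite S" "set i \<subseteq> S" for S
    using that
  proof (induction i)
    case (Cons a i)
    have "(\<Prod>k\<in>S. f k ^ count_list (a # i) k) = (\<Prod>k\<in>S. (if k = a then f k else 1) * f k ^ count_list i k)"
      by (intro prod.cong) auto
    then show ?case using Cons by (simp add: prod.distrib)
  qed simp
  then show ?thesis by simp
qed

lemma c_idx_eq_prod_list:
  "c_idx i = prod_list (map (\<lambda>k. idx_weight i * real (count_list i k)) i)"
  unfolding c_idx_def prod_list_map_eq_prod_count
  by (intro prod.cong refl) (simp only: multinom_eq_idx_weight)

lemma card_permutations_remove_eq_idx_weight:
  assumes "k \<in> set i"
  shows "real (card (permutations_of_multiset (mset i - {#k#}))) = idx_weight i * real (count_list i k)"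
proof -
  define P where "P = (\<Prod>j\<in>set i. fact (count_list i j) :: nat)"
  have len: "length i > 0" using assms by auto
  have P: "P > 0" by (simp add: P_def prod_pos)
  have 1: "card (permutations_of_multiset (mset i)) * P = fact (length i)"
    using card_permutations_of_multiset_aux[of "mset i"] by (simp add: P_def count_mset)
  have 2: "card (permutations_of_multiset (mset i)) * count_list i k =
      length i * card (permutations_of_multiset (mset i - {#k#}))"
    using card_permutations_of_multiset_remove_aux[of k "mset i"] assms by (simp add: count_mset)
  have "length i * (card (permutations_of_multiset (mset i - {#k#})) * P) = fact (length i) * count_list i k"
    using 1 2 by (metis mult.assoc mult.commute)
  also have "fact (length i) = length i * fact (length i - 1)" using len by (simp add: fact_reduce)
  finally have "card (permutations_of_multiset (mset i - {#k#})) * P = fact (length i - 1) * count_list i k"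
    using len by simp
  then have "real (card (permutations_of_multiset (mset i - {#k#}))) * real P = fact (length i - 1) * real (count_list i k)"
    by (metis of_nat_fact of_nat_mult)
  also have "fact (length i - 1) = idx_weight i * real P"
    using P by (simp add: idx_weight_def P_def)
  finally have "real (card (permutations_of_multiset (mset i - {#k#}))) * real P =
      idx_weight i * real (count_list i k) * real P" by (simp only: mult_ac)
  then show ?thesis using P by simp
qed

lemma diag_idx_replicate: "diag_idx (replicate m k)"
  by (auto simp: diag_idx_def)

lemma diag_idx_alt: "diag_idx i \<longleftrightarrow> (\<forall>j\<in>set i. \<forall>k\<in>set i. j = k)"
proof
  assume *: "\<forall>j\<in>set i. \<forall>k\<in>set i. j = k"
  show "diag_idx i"
  proof (cases i)
    case (Cons a l)
    then have "i = replicate (length i) a"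
      using * by (intro replicate_eqI) auto
    then show ?thesis unfolding diag_idx_def by blast
  qed (simp add: diag_idx_def)
next
  assume "diag_idx i"
  then obtain j where "i = replicate (length i) j" unfolding diag_idx_def by blast
  then have "set i \<subseteq> {j}" by (metis set_replicate_conv_if empty_subsetI order_refl)
  then show "\<forall>j\<in>set i. \<forall>k\<in>set i. j = k" by blast
qed

text \<open>
  Prefixing \<open>k\<close> and sorting sends the tail indices of row \<open>k\<close> to the sorted indices containing
  \<open>k\<close>. By symmetry all tails over the sorted index \<open>i\<close> contribute equally, and there are as many
  of them as rearrangements of \<open>i\<close> without one copy of \<open>k\<close>. The factor \<open>x k\<close> makes the monomials
  symmetric as well.
\<close>

lemma row_sum_eq_sorted_sum:
  assumes T: "symmetric_tensor m n T" and k: "k \<in> {1..n}" and m: "m \<ge> 1"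
  shows "x k * (\<Sum>js\<in>tensor_idx (m - 1) n. T (k # js) * prod_list (map x js)) =
    T (replicate m k) * x k ^ m +
    (\<Sum>i\<in>offdiag_idx m n. idx_weight i * real (count_list i k) * T i * prod_list (map x i))"
proof -
  define J where "J = {i \<in> tensor_idx m n. sorted i \<and> k \<in> set i}"
  define h where "h i = T i * prod_list (map x i)" for i
  have cons: "k # js \<in> tensor_idx m n" if "js \<in> tensor_idx (m - 1) n" for js
    using that k m by (auto simp: tensor_idx_def)
  have sort_in: "sort (k # js) \<in> J" if "js \<in> tensor_idx (m - 1) n" for js
    using that k m unfolding J_def tensor_idx_def by (simp del: sort_key_simps)
  have h_sort: "x k * (T (k # js) * prod_list (map x js)) = h (sort (k # js))"
    if "js \<in> tensor_idx (m - 1) n" for js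
  proof -
    have "T (sort (k # js)) = T (k # js)"
      using T cons[OF that] unfolding symmetric_tensor_def by (metis mset_sort)
    moreover have "prod_list (map x (sort (k # js))) = prod_list (map x (k # js))"
      by (metis mset_map mset_sort prod_mset_prod_list)
    ultimately show ?thesis by (simp add: h_def del: sort_key_simps)
  qed
  have fiber: "{js \<in> tensor_idx (m - 1) n. sort (k # js) = i} = permutations_of_multiset (mset i - {#k#})"
    if i: "i \<in> J" for i
  proof (intro equalityI subsetI)
    fix js assume "js \<in> {js \<in> tensor_idx (m - 1) n. sort (k # js) = i}"
    then have "mset i = mset (k # js)" by (metis (mono_tags) mem_Collect_eq mset_sort)
    then show "js \<in> permutations_of_multiset (mset i - {#k#})"
      by (intro permutations_of_multisetI) simp
  next
    fix js assume "js \<in> permutations_of_multiset (mset i - {#k#})"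
    then have "mset js = mset i - {#k#}" by (rule permutations_of_multisetD)
    then have eq: "mset (k # js) = mset i" using i by (simp add: J_def)
    then have "sort (k # js) = i" using i by (intro properties_for_sort) (auto simp: J_def)
    moreover have "length (k # js) = length i" "set (k # js) = set i"
      using eq by (metis mset_eq_length, metis mset_eq_setD)
    then have "js \<in> tensor_idx (m - 1) n" using i by (auto simp: J_def tensor_idx_def)
    ultimately show "js \<in> {js \<in> tensor_idx (m - 1) n. sort (k # js) = i}" by simp
  qed
  have finJ: "finite J" using finite_tensor_idx[of m n] by (simp add: J_def)
  have rep: "replicate m k \<in> J" using k m by (auto simp: J_def tensor_idx_def sorted_replicate)
  have J_rep: "J - {replicate m k} = {i \<in> offdiag_idx m n. k \<in> set i}"
  proof -
    have "diag_idx i \<longleftrightarrow> i = replicate m k" if "i \<in> J" for i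
    proof
      assume "diag_idx i"
      then show "i = replicate m k"
        using that by (intro replicate_eqI) (auto simp: J_def tensor_idx_def diag_idx_alt)
    qed (simp add: diag_idx_replicate)
    then show ?thesis by (auto simp: J_def offdiag_idx_def diag_idx_replicate)
  qed
  have w_rep: "idx_weight (replicate m k) * real (count_list (replicate m k) k) = 1"
  proof -
    have "count_list (replicate m k) k = m" by (induction m) auto
    then show ?thesis using m by (simp add: idx_weight_def fact_reduce[of m])
  qed
  have "x k * (\<Sum>js\<in>tensor_idx (m - 1) n. T (k # js) * prod_list (map x js))
      = (\<Sum>js\<in>tensor_idx (m - 1) n. h (sort (k # js)))"
    unfolding sum_distrib_left by (intro sum.cong refl h_sort)
  also have "\<dots> = (\<Sum>i\<in>J. \<Sum>js\<in>{js \<in> tensor_idx (m - 1) n. sort (k # js) = i}. h (sort (k # js)))"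
    using finJ sort_in by (intro sum.group[symmetric] finite_tensor_idx) auto
  also have "\<dots> = (\<Sum>i\<in>J. idx_weight i * real (count_list i k) * h i)"
  proof (intro sum.cong refl)
    fix i assume i: "i \<in> J"
    have "(\<Sum>js\<in>{js \<in> tensor_idx (m - 1) n. sort (k # js) = i}. h (sort (k # js)))
        = real (card {js \<in> tensor_idx (m - 1) n. sort (k # js) = i}) * h i"
      by (simp del: sort_key_simps)
    then show "(\<Sum>js\<in>{js \<in> tensor_idx (m - 1) n. sort (k # js) = i}. h (sort (k # js)))
        = idx_weight i * real (count_list i k) * h i"
      using i card_permutations_remove_eq_idx_weight[of k i] unfolding fiber[OF i] by (simp add: J_def)
  qed
  also have "\<dots> = h (replicate m k) + (\<Sum>i\<in>{i \<in> offdiag_idx m n. k \<in> set i}.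
      idx_weight i * real (count_list i k) * h i)"
    using finJ rep w_rep by (simp add: sum.remove[of J "replicate m k"] J_rep)
  also have "(\<Sum>i\<in>{i \<in> offdiag_idx m n. k \<in> set i}. idx_weight i * real (count_list i k) * h i)
      = (\<Sum>i\<in>offdiag_idx m n. idx_weight i * real (count_list i k) * h i)"
    by (intro sum.mono_neutral_left finite_offdiag_idx) (auto simp: count_list_0_iff)
  finally show ?thesis by (simp add: h_def mult.assoc)
qed

section \<open>Generalized diagonal dominance, the spectral radius and copositivity\<close>

text \<open>
  The absolute off-diagonal sum of row \<open>k\<close> at \<open>d\<close>, multiplied by \<open>d k\<close> so that it is a
  sum over sorted indices of monomials of full degree \<open>m\<close>.
\<close>

definition offdiag_row :: "nat \<Rightarrow> nat \<Rightarrow> tensor \<Rightarrow> (nat \<Rightarrow> real) \<Rightarrow> nat \<Rightarrow> real" where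
  "offdiag_row m n A d k =
     (\<Sum>i\<in>offdiag_idx m n. real (count_list i k) * (idx_weight i * \<bar>A i\<bar>) * prod_list (map d i))"

definition scaled_dominance :: "nat \<Rightarrow> nat \<Rightarrow> tensor \<Rightarrow> (nat \<Rightarrow> real) \<Rightarrow> bool" where
  "scaled_dominance m n A d \<longleftrightarrow> (\<forall>k\<in>{1..n}. d k > 0) \<and>
     (\<forall>k\<in>{1..n}. offdiag_row m n A d k \<le> \<bar>A (replicate m k)\<bar> * d k ^ m)"

text \<open>
  Nonnegativity of the form of the comparison tensor on the nonnegative orthant; the coefficient
  \<open>m * idx_weight i\<close> is the number of rearrangements of \<open>i\<close>.
\<close>

definition comparison_copositive :: "nat \<Rightarrow> nat \<Rightarrow> tensor \<Rightarrow> bool" where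
  "comparison_copositive m n A \<longleftrightarrow>
     (\<forall>x. (\<forall>j. x j \<ge> 0) \<longrightarrow>
        real m * (\<Sum>i\<in>offdiag_idx m n. (idx_weight i * \<bar>A i\<bar>) * prod_list (map x i))
          \<le> (\<Sum>k\<in>{1..n}. \<bar>A (replicate m k)\<bar> * x k ^ m))"

lemma offdiag_idxD:
  assumes "i \<in> offdiag_idx m n"
  shows "length i = m" "set i \<subseteq> {1..n}" "sorted i" "\<not> diag_idx i" "i \<in> tensor_idx m n"
  using assms by (auto simp: offdiag_idx_def tensor_idx_def)

lemma diag_idx_mset_cong:
  assumes "mset j = mset i"
  shows "diag_idx j \<longleftrightarrow> diag_idx i"
  using mset_eq_setD[OF assms] by (simp add: diag_idx_alt)

lemma tensor_idx_mset_cong: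
  assumes "mset j = mset i"
  shows "j \<in> tensor_idx m n \<longleftrightarrow> i \<in> tensor_idx m n"
  using mset_eq_setD[OF assms] mset_eq_length[OF assms] by (simp add: tensor_idx_def)

lemma replicate_in_tensor_idx: "k \<in> {1..n} \<Longrightarrow> replicate m k \<in> tensor_idx m n"
  by (auto simp: tensor_idx_def)

lemma copositive_imp_dominance:
  assumes "m \<ge> 2" "comparison_copositive m n A"
  shows "\<exists>d. scaled_dominance m n A d"
  unfolding scaled_dominance_def offdiag_row_def
proof (rule copositive_imp_scaled_dominance)
  show "length i = m \<and> set i \<subseteq> {1..n}" if "i \<in> offdiag_idx m n" for i
    using offdiag_idxD[OF that] by simp
  show "idx_weight i * \<bar>A i\<bar> \<ge> 0" for i by (simp add: idx_weight_nonneg)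
qed (use assms in \<open>simp_all add: finite_offdiag_idx comparison_copositive_def\<close>)

text \<open>
  Multiplying row \<open>k\<close> of the scaled tensor by \<open>d k ^ m\<close> clears the negative power of \<open>d k\<close>.
\<close>

lemma GDD_iff_scaled_dominance:
  assumes A: "symmetric_tensor m n A" and m: "m \<ge> 2"
  shows "GDD_tensor m n A \<longleftrightarrow> (\<exists>d. scaled_dominance m n A d)"
proof -
  have "(\<Sum>js\<in>tensor_idx (m - 1) n - {replicate (m - 1) k}.
          \<bar>A (k # js) * d k powi (1 - int m) * prod_list (map d js)\<bar>)
        \<le> \<bar>A (replicate m k) * d k powi (1 - int m) * prod_list (map d (replicate (m - 1) k))\<bar>
      \<longleftrightarrow> offdiag_row m n A d k \<le> \<bar>A (replicate m k)\<bar> * d k ^ m"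
    if d: "\<forall>i\<in>{1..n}. d i > 0" and k: "k \<in> {1..n}" for d k
  proof -
    define r where "r = d k powi (1 - int m)"
    define X where "X = (\<Sum>js\<in>tensor_idx (m - 1) n - {replicate (m - 1) k}. \<bar>A (k # js)\<bar> * prod_list (map d js))"
    have dk: "d k > 0" using d k by auto
    have r: "r > 0" using dk by (simp add: r_def)
    have rm: "r * d k ^ (m - 1) = 1"
    proof -
      have "1 - int m = - int (m - 1)" using m by simp
      then have "r = inverse (d k ^ (m - 1))"
        unfolding r_def by (simp only: power_int_minus power_int_of_nat)
      then show ?thesis using dk by simp
    qed
    have pos: "prod_list (map d js) > 0" if "js \<in> tensor_idx (m - 1) n" for js
      using that d by (intro prod_list_map_pos) (auto simp: tensor_idx_def)
    have km: "k # replicate (m - 1) k = replicate m k" using m by (cases m) auto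
    have "symmetric_tensor m n (\<lambda>i. \<bar>A i\<bar>)" using A unfolding symmetric_tensor_def by metis
    from row_sum_eq_sorted_sum[OF this k, of d]
    have row: "d k * (\<Sum>js\<in>tensor_idx (m - 1) n. \<bar>A (k # js)\<bar> * prod_list (map d js))
        = \<bar>A (replicate m k)\<bar> * d k ^ m + offdiag_row m n A d k"
      using m by (simp add: offdiag_row_def mult_ac)
    have "(\<Sum>js\<in>tensor_idx (m - 1) n. \<bar>A (k # js)\<bar> * prod_list (map d js))
        = \<bar>A (replicate m k)\<bar> * d k ^ (m - 1) + X"
      using finite_tensor_idx[of "m - 1" n] replicate_in_tensor_idx[OF k, of "m - 1"]
      by (simp add: sum.remove[of _ "replicate (m - 1) k"] X_def km[simplified])
    moreover have dm: "d k ^ m = d k * d k ^ (m - 1)" using m by (cases m) auto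
    ultimately have X: "d k * X = offdiag_row m n A d k" using row by (simp add: algebra_simps)
    have L: "(\<Sum>js\<in>tensor_idx (m - 1) n - {replicate (m - 1) k}.
          \<bar>A (k # js) * r * prod_list (map d js)\<bar>) = r * X"
      unfolding X_def sum_distrib_left
      using pos r by (intro sum.cong refl) (auto simp: abs_mult less_imp_le)
    have R: "\<bar>A (replicate m k) * r * prod_list (map d (replicate (m - 1) k))\<bar> = \<bar>A (replicate m k)\<bar>"
    proof -
      have "A (replicate m k) * r * prod_list (map d (replicate (m - 1) k)) = A (replicate m k) * (r * d k ^ (m - 1))"
        by simp
      then show ?thesis by (simp only: rm)
    qed
    have "r * X \<le> \<bar>A (replicate m k)\<bar> \<longleftrightarrow> d k ^ m * (r * X) \<le> d k ^ m * \<bar>A (replicate m k)\<bar>"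
      using dk by simp
    also have "d k ^ m * (r * X) = (r * d k ^ (m - 1)) * (d k * X)" by (simp add: dm)
    also have "\<dots> = offdiag_row m n A d k" by (simp only: rm X mult_1_left)
    finally show ?thesis unfolding r_def[symmetric] L R by (simp add: mult.commute)
  qed
  moreover have "replicate m k = k # replicate (m - 1) k" for k :: nat using m by (cases m) auto
  then have "hd (replicate m k) = k" "tl (replicate m k) = replicate (m - 1) k" for k :: nat
    by simp_all
  ultimately show ?thesis
    unfolding GDD_tensor_def DD_tensor_def scaled_dominance_def
    by (simp del: map_replicate prod_list_replicate abs_mult cong: conj_cong)
qed

text \<open>
  The Collatz-Wielandt upper bound: evaluate the eigenvalue equation in a row in which the ratio
  of the modulus of the eigenvector to \<open>d\<close> is largest.
\<close>

lemma tensor_eigenvalue_bound: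
  assumes D: "\<And>i. i \<in> tensor_idx m n \<Longrightarrow> D i \<ge> 0" and m: "m \<ge> 1"
    and d: "\<And>k. k \<in> {1..n} \<Longrightarrow> d k > 0"
    and row: "\<And>k. k \<in> {1..n} \<Longrightarrow>
      (\<Sum>js\<in>tensor_idx (m - 1) n. D (k # js) * prod_list (map d js)) \<le> s * d k ^ (m - 1)"
    and \<mu>: "tensor_eigenvalue m n D \<mu>"
  shows "cmod \<mu> \<le> s"
proof -
  obtain x i where i: "i \<in> {1..n}" "x i \<noteq> 0"
    and x: "\<And>k. k \<in> {1..n} \<Longrightarrow> (\<Sum>js\<in>tensor_idx (m - 1) n. complex_of_real (D (k # js)) * prod_list (map x js))
                      = \<mu> * x k ^ (m - 1)"
    using \<mu> unfolding tensor_eigenvalue_def by blast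
  define q where "q k = cmod (x k) / d k" for k
  have "\<exists>k\<in>{1..n}. \<forall>j\<in>{1..n}. q j \<le> q k"
  proof -
    have "Max (q ` {1..n}) \<in> q ` {1..n}" using i by (intro Max_in) auto
    then obtain k where "k \<in> {1..n}" "q k = Max (q ` {1..n})" by auto
    then show ?thesis by (metis Max_ge finite_atLeastAtMost finite_imageI image_eqI)
  qed
  then obtain k where k: "k \<in> {1..n}" and max: "\<And>j. j \<in> {1..n} \<Longrightarrow> q j \<le> q k" by blast
  have "q i > 0" using i d by (simp add: q_def)
  then have qk: "q k > 0" using max[OF i(1)] by simp
  have xk: "cmod (x k) = q k * d k" using d[OF k] by (simp add: q_def)
  have le: "cmod (x j) \<le> q k * d j" if "j \<in> {1..n}" for j
    using max[OF that] d[OF that] by (simp add: q_def[of j] divide_le_eq)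
  have summand: "cmod (complex_of_real (D (k # js)) * prod_list (map x js))
      \<le> q k ^ (m - 1) * (D (k # js) * prod_list (map d js))" if js: "js \<in> tensor_idx (m - 1) n" for js
  proof -
    have "cmod (prod_list (map x js)) = prod_list (map (\<lambda>j. cmod (x j)) js)"
      by (induction js) (auto simp: norm_mult)
    also have "\<dots> \<le> prod_list (map (\<lambda>j. q k * d j) js)"
      using js le by (intro prod_list_map_mono) (auto simp: tensor_idx_def)
    also have "\<dots> = q k ^ (m - 1) * prod_list (map d js)"
      using js by (simp add: prod_list_map_scale tensor_idx_def)
    finally have "cmod (prod_list (map x js)) \<le> q k ^ (m - 1) * prod_list (map d js)" .
    moreover have "D (k # js) \<ge> 0" using js k m by (intro D) (auto simp: tensor_idx_def)
    ultimately have "D (k # js) * cmod (prod_list (map x js))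
        \<le> D (k # js) * (q k ^ (m - 1) * prod_list (map d js))" by (intro mult_left_mono)
    then show ?thesis using \<open>D (k # js) \<ge> 0\<close> by (simp add: norm_mult mult_ac)
  qed
  have "cmod \<mu> * (q k * d k) ^ (m - 1) = cmod (\<Sum>js\<in>tensor_idx (m - 1) n. complex_of_real (D (k # js)) * prod_list (map x js))"
    using x[OF k] by (simp add: norm_mult norm_power xk)
  also have "\<dots> \<le> (\<Sum>js\<in>tensor_idx (m - 1) n. q k ^ (m - 1) * (D (k # js) * prod_list (map d js)))"
    using summand by (intro sum_norm_le)
  also have "\<dots> \<le> q k ^ (m - 1) * (s * d k ^ (m - 1))"
    unfolding sum_distrib_left[symmetric] using qk by (intro mult_left_mono row k) auto
  also have "\<dots> = s * (q k * d k) ^ (m - 1)" by (simp add: power_mult_distrib)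
  finally show ?thesis using qk d[OF k] by simp
qed

lemma comparison_splitting:
  assumes A: "symmetric_tensor m n A"
    and D: "Z_splitting m n (comparison_tensor A) s D"
  shows "k \<in> {1..n} \<Longrightarrow> D (replicate m k) = s - \<bar>A (replicate m k)\<bar>"
    and "i \<in> offdiag_idx m n \<Longrightarrow> D i = \<bar>A i\<bar>"
    and "symmetric_tensor m n D"
proof -
  have eq: "D i = s * unit_tensor i - comparison_tensor A i" if "i \<in> tensor_idx m n" for i
    using D that by (simp add: Z_splitting_def)
  show "D (replicate m k) = s - \<bar>A (replicate m k)\<bar>" if "k \<in> {1..n}" for k
    using eq[OF replicate_in_tensor_idx[OF that]]
    by (simp add: unit_tensor_def comparison_tensor_def diag_idx_replicate)
  show "D i = \<bar>A i\<bar>" if "i \<in> offdiag_idx m n" for i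
    using eq[OF offdiag_idxD(5)[OF that]] offdiag_idxD(4)[OF that]
    by (simp add: unit_tensor_def comparison_tensor_def)
  show "symmetric_tensor m n D"
    unfolding symmetric_tensor_def
  proof (intro ballI allI impI)
    fix i j assume i: "i \<in> tensor_idx m n" and j: "mset j = mset i"
    have "A j = A i" using A i j unfolding symmetric_tensor_def by blast
    then show "D j = D i"
      using i j diag_idx_mset_cong[OF j] tensor_idx_mset_cong[OF j]
      by (simp add: eq unit_tensor_def comparison_tensor_def)
  qed
qed

lemma splitting_row_sum:
  assumes A: "symmetric_tensor m n A" and m: "m \<ge> 2"
    and D: "Z_splitting m n (comparison_tensor A) s D" and k: "k \<in> {1..n}"
  shows "x k * (\<Sum>js\<in>tensor_idx (m - 1) n. D (k # js) * prod_list (map x js))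
    = (s - \<bar>A (replicate m k)\<bar>) * x k ^ m + offdiag_row m n A x k"
  using row_sum_eq_sorted_sum[OF comparison_splitting(3)[OF A D] k, of x] m
    comparison_splitting(1,2)[OF A D] k
  by (simp add: offdiag_row_def mult_ac)

text \<open>
  A dominating scaling is a Collatz-Wielandt vector, so all eigenvalues of \<open>D = s I - M(A)\<close> have
  modulus at most \<open>s\<close> as soon as \<open>s\<close> is large enough for \<open>D\<close> to be nonnegative.
\<close>

lemma dominance_imp_H_tensor:
  assumes A: "symmetric_tensor m n A" and m: "m \<ge> 2" and dom: "scaled_dominance m n A d"
  shows "H_tensor m n A"
proof -
  \<comment> \<open>Including the default value of \<open>Sup {}\<close> avoids proving that \<open>D\<close> has an eigenvalue,
    which fails in dimension \<open>0\<close>.\<close>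
  define s where "s = max (\<Sum>k\<in>{1..n}. \<bar>A (replicate m k)\<bar>) (Sup {})"
  define D where "D i = s * unit_tensor i - comparison_tensor A i" for i
  have diag: "\<bar>A (replicate m k)\<bar> \<le> s" if "k \<in> {1..n}" for k
  proof -
    have "\<bar>A (replicate m k)\<bar> \<le> (\<Sum>k\<in>{1..n}. \<bar>A (replicate m k)\<bar>)"
      using that by (intro member_le_sum) auto
    then show ?thesis by (simp add: s_def)
  qed
  have s0: "s \<ge> 0" by (simp add: s_def le_max_iff_disj sum_nonneg)
  have D0: "D i \<ge> 0" if i: "i \<in> tensor_idx m n" for i
  proof (cases "diag_idx i")
    case True
    then obtain k where k: "i = replicate m k" using i by (auto simp: diag_idx_def tensor_idx_def)
    then have "k \<in> {1..n}" using i m by (simp add: tensor_idx_def)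
    from diag[OF this] show ?thesis
      by (simp add: D_def unit_tensor_def comparison_tensor_def k diag_idx_replicate)
  qed (simp add: D_def unit_tensor_def comparison_tensor_def)
  have split: "Z_splitting m n (comparison_tensor A) s D"
    using s0 D0 by (simp add: Z_splitting_def D_def)
  have d: "\<And>k. k \<in> {1..n} \<Longrightarrow> d k > 0" using dom by (simp add: scaled_dominance_def)
  have bound: "cmod \<mu> \<le> s" if "tensor_eigenvalue m n D \<mu>" for \<mu>
  proof (rule tensor_eigenvalue_bound[OF D0 _ d _ that])
    fix k assume k: "k \<in> {1..n}"
    have "d k * (\<Sum>js\<in>tensor_idx (m - 1) n. D (k # js) * prod_list (map d js)) \<le> s * d k ^ m"
      unfolding splitting_row_sum[OF A m split k]
      using dom k by (simp add: scaled_dominance_def algebra_simps)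
    also have "\<dots> = d k * (s * d k ^ (m - 1))" using m by (cases m) auto
    finally show "(\<Sum>js\<in>tensor_idx (m - 1) n. D (k # js) * prod_list (map d js)) \<le> s * d k ^ (m - 1)"
      using d[OF k] by simp
  qed (use m in auto)
  have "tensor_rho m n D \<le> s"
  proof (cases "{\<mu>. tensor_eigenvalue m n D \<mu>} = {}")
    case True
    then show ?thesis by (simp only: tensor_rho_def image_empty s_def max.cobounded2)
  next
    case False
    then show ?thesis unfolding tensor_rho_def using bound by (intro cSup_least) auto
  qed
  then show ?thesis using split unfolding H_tensor_def M_tensor_def by blast
qed

text \<open>
  A maximizer of the form of \<open>D\<close> is an eigenvector for the maximum \<open>l\<close>: on its support this is
  stationarity, and in the other rows both sides vanish because no nonzero entry of \<open>D\<close> mixes the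
  support with its complement. So \<open>l \<le> \<rho>(D) \<le> s\<close>, and the form of \<open>s I - D\<close> is nonnegative.
\<close>

lemma H_tensor_imp_copositive:
  assumes A: "symmetric_tensor m n A" and m: "m \<ge> 2" and H: "H_tensor m n A"
  shows "comparison_copositive m n A"
proof (cases "n = 0")
  case True
  have "offdiag_idx m n = {}" using True m by (auto simp: offdiag_idx_def tensor_idx_def)
  then show ?thesis using True by (simp add: comparison_copositive_def)
next
  case False
  obtain s D where split: "Z_splitting m n (comparison_tensor A) s D" and s: "tensor_rho m n D \<le> s"
    using H unfolding H_tensor_def M_tensor_def by blast
  have D0: "D i \<ge> 0" if "i \<in> tensor_idx m n" for i
    using split that by (simp add: Z_splitting_def)
  note D = comparison_splitting[OF A split]
  interpret dominated_form m "{1..n}" "\<lambda>k. D (replicate m k)" "offdiag_idx m n"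
      "\<lambda>i. real m * (idx_weight i * \<bar>A i\<bar>)"
    using m False finite_offdiag_idx offdiag_idxD(1,2) idx_weight_nonneg
    by unfold_locales (auto intro!: mult_nonneg_nonneg)
  obtain x where x: "\<And>j. x j \<ge> 0" "\<And>j. j \<notin> {1..n} \<Longrightarrow> x j = 0" "(\<Sum>j\<in>{1..n}. x j ^ m) = 1"
    and max: "\<forall>y. (\<forall>j. y j \<ge> 0) \<longrightarrow> form y \<le> form x * (\<Sum>j\<in>{1..n}. y j ^ m)"
    using maximizer_exists by blast
  define l where "l = form x"
  have max': "form x = l * (\<Sum>j\<in>{1..n}. x j ^ m)"
    and max: "\<And>y. (\<And>j. y j \<ge> 0) \<Longrightarrow> form y \<le> l * (\<Sum>j\<in>{1..n}. y j ^ m)"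
    using x(3) max by (simp_all add: l_def)
  have eigen: "(\<Sum>js\<in>tensor_idx (m - 1) n. D (k # js) * prod_list (map x js)) = l * x k ^ (m - 1)"
    if k: "k \<in> {1..n}" for k
  proof (cases "x k = 0")
    case False
    have "real m * (D (replicate m k) * x k ^ m + offdiag_row m n A x k) = real m * (l * x k ^ m)"
      using maximizer_stationary[OF x(1) k max' max]
      by (simp add: offdiag_row_def sum_distrib_left algebra_simps)
    then have "D (replicate m k) * x k ^ m + offdiag_row m n A x k = l * x k ^ m" using m by simp
    then have "x k * (\<Sum>js\<in>tensor_idx (m - 1) n. D (k # js) * prod_list (map x js)) = l * x k ^ m"
      using splitting_row_sum[OF A m split k, of x] D(1)[OF k] by simp
    also have "\<dots> = x k * (l * x k ^ (m - 1))" using m by (cases m) auto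
    finally show ?thesis using False by simp
  next
    case True
    have "D (k # js) * prod_list (map x js) = 0" if js: "js \<in> tensor_idx (m - 1) n" for js
    proof (cases "\<exists>j\<in>set js. x j = 0")
      case True
      then show ?thesis using prod_list_map_eq_0 by (metis mult_zero_right)
    next
      case nz: False
      have "length js \<noteq> 0" using js m by (simp add: tensor_idx_def)
      then obtain j where j: "j \<in> set js" by (cases js) auto
      define i where "i = sort (k # js)"
      have i: "mset i = mset (k # js)" unfolding i_def by (rule mset_sort)
      have T: "k # js \<in> tensor_idx m n" using js k m by (auto simp: tensor_idx_def)
      have set: "set i = insert k (set js)" using mset_eq_setD[OF i] by simp
      have "x j \<noteq> 0" using nz j by auto
      then have "\<not> diag_idx i" using j set True by (auto simp: diag_idx_alt)
      then have iE: "i \<in> offdiag_idx m n"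
        using T tensor_idx_mset_cong[OF i] by (simp add: offdiag_idx_def i_def del: sort_key_simps)
      have "real m * (idx_weight i * \<bar>A i\<bar>) = 0"
        using maximizer_support_closed[OF x(1) max' max iE, of j k] set j \<open>x j \<noteq> 0\<close> True by simp
      moreover have "idx_weight i \<noteq> 0" by (simp add: idx_weight_def)
      ultimately have "D i = 0" using m D(2)[OF iE] by simp
      moreover have "D i = D (k # js)" using D(3) T i unfolding symmetric_tensor_def by blast
      ultimately show ?thesis by simp
    qed
    then have "(\<Sum>js\<in>tensor_idx (m - 1) n. D (k # js) * prod_list (map x js)) = 0"
      by (intro sum.neutral) blast
    then show ?thesis using True m by (simp add: power_0_left)
  qed
  have "\<exists>k\<in>{1..n}. x k \<noteq> 0"
  proof (rule ccontr)
    assume "\<not> ?thesis"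
    then have "(\<Sum>j\<in>{1..n}. x j ^ m) = 0" using m by (intro sum.neutral) (auto simp: power_0_left)
    then show False using x(3) by simp
  qed
  moreover have "(\<Sum>js\<in>tensor_idx (m - 1) n. complex_of_real (D (k # js)) * prod_list (map (\<lambda>j. complex_of_real (x j)) js))
      = complex_of_real l * complex_of_real (x k) ^ (m - 1)" if "k \<in> {1..n}" for k
  proof -
    have "prod_list (map (\<lambda>j. complex_of_real (x j)) js) = complex_of_real (prod_list (map x js))" for js
      by (induction js) auto
    then show ?thesis using arg_cong[OF eigen[OF that], of complex_of_real] by simp
  qed
  ultimately have l: "tensor_eigenvalue m n D (complex_of_real l)"
    unfolding tensor_eigenvalue_def by (intro exI[of _ "\<lambda>j. complex_of_real (x j)"]) auto
  \<comment> \<open>The supremum defining the spectral radius is an upper bound only for a bounded set;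
    the row sums bound the eigenvalues, and their total serves as a common bound.\<close>
  have bdd: "bdd_above (cmod ` {\<mu>. tensor_eigenvalue m n D \<mu>})"
  proof -
    define R where "R = (\<Sum>k\<in>{1..n}. \<Sum>js\<in>tensor_idx (m - 1) n. D (k # js))"
    have "cmod \<mu> \<le> R" if "tensor_eigenvalue m n D \<mu>" for \<mu>
    proof (rule tensor_eigenvalue_bound[OF D0 _ _ _ that, of "\<lambda>_. 1"])
      fix k assume k: "k \<in> {1..n}"
      have "(\<Sum>js\<in>tensor_idx (m - 1) n. D (k # js)) \<le> R"
        unfolding R_def using k m
        by (intro member_le_sum[of k "{1..n}" "\<lambda>k. \<Sum>js\<in>tensor_idx (m - 1) n. D (k # js)"])
          (auto intro!: sum_nonneg D0 simp: tensor_idx_def)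
      moreover have "prod_list (map (\<lambda>_. 1) js) = (1::real)" for js :: "nat list" by (induction js) auto
      ultimately show "(\<Sum>js\<in>tensor_idx (m - 1) n. D (k # js) * prod_list (map (\<lambda>_. 1) js)) \<le> R * 1 ^ (m - 1)"
        by simp
    qed (use m in auto)
    then show ?thesis by (intro bdd_aboveI2) auto
  qed
  have "l \<le> cmod (complex_of_real l)" by simp
  also have "\<dots> \<le> tensor_rho m n D" unfolding tensor_rho_def using l bdd by (intro cSup_upper imageI) simp_all
  finally have ls: "l \<le> s" using s by simp
  show ?thesis
    unfolding comparison_copositive_def
  proof (intro allI impI)
    fix y :: "nat \<Rightarrow> real" assume y: "\<forall>j. y j \<ge> 0"
    have "form y \<le> l * (\<Sum>j\<in>{1..n}. y j ^ m)" using y by (intro max) auto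
    also have "\<dots> \<le> s * (\<Sum>j\<in>{1..n}. y j ^ m)" using ls y by (intro mult_right_mono sum_nonneg) auto
    finally have "form y \<le> s * (\<Sum>j\<in>{1..n}. y j ^ m)" .
    moreover have "form y = s * (\<Sum>j\<in>{1..n}. y j ^ m) - (\<Sum>k\<in>{1..n}. \<bar>A (replicate m k)\<bar> * y k ^ m)
        + real m * (\<Sum>i\<in>offdiag_idx m n. (idx_weight i * \<bar>A i\<bar>) * prod_list (map y i))"
      unfolding form_def using D(1) by (simp add: sum_distrib_left left_diff_distrib right_diff_distrib sum_subtractf mult_ac)
    ultimately show "real m * (\<Sum>i\<in>offdiag_idx m n. (idx_weight i * \<bar>A i\<bar>) * prod_list (map y i))
          \<le> (\<Sum>k\<in>{1..n}. \<bar>A (replicate m k)\<bar> * y k ^ m)" by simp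
  qed
qed

section \<open>Towers of power cones\<close>

lemma power_cone_inverse_nat_iff:
  assumes k: "k \<ge> 2"
  shows "(x1, x2, z) \<in> power_cone (1 / real k) \<longleftrightarrow>
    x1 \<ge> 0 \<and> x2 \<ge> 0 \<and> \<bar>z\<bar> ^ k \<le> x1 * x2 ^ (k - 1)"
proof -
  have "\<bar>z\<bar> \<le> cone_pow x1 (1 / real k) * cone_pow x2 (1 - 1 / real k) \<longleftrightarrow>
      \<bar>z\<bar> ^ k \<le> x1 * x2 ^ (k - 1)" if x: "x1 \<ge> 0" "x2 \<ge> 0"
  proof -
    have 1: "cone_pow x1 (1 / real k) = x1 powr (1 / real k)"
      and 2: "cone_pow x2 (1 - 1 / real k) = x2 powr (1 - 1 / real k)"
      using k by (auto simp: cone_pow_def)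
    have pw: "(y powr a) ^ k = y powr (a * real k)" for y a :: real
      using k powr_realpow'[of "y powr a" k] by (simp add: powr_powr)
    have "(x1 powr (1 / real k)) ^ k = x1"
      unfolding pw using k x by simp
    moreover have "(x2 powr (1 - 1 / real k)) ^ k = x2 ^ (k - 1)"
    proof -
      have "(x2 powr (1 - 1 / real k)) ^ k = x2 powr ((1 - 1 / real k) * real k)"
        by (rule pw)
      also have "(1 - 1 / real k) * real k = real (k - 1)" using k by (simp add: field_simps of_nat_diff)
      also have "x2 powr real (k - 1) = x2 ^ (k - 1)" using k x by (intro powr_realpow') auto
      finally show ?thesis .
    qed
    ultimately have "(x1 powr (1 / real k) * x2 powr (1 - 1 / real k)) ^ k = x1 * x2 ^ (k - 1)"
      by (simp only: power_mult_distrib)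
    then show ?thesis unfolding 1 2 using k by (subst power_mono_iff[symmetric, of _ _ k]) auto
  qed
  then show ?thesis by (auto simp: power_cone_def)
qed

text \<open>
  The cone constraints of one off-diagonal index, with \<open>f l\<close> for the variable at list position \<open>l\<close>
  and \<open>z\<close> for the constant.
\<close>

definition cone_tower :: "nat \<Rightarrow> (nat \<Rightarrow> real) \<Rightarrow> (nat \<Rightarrow> real) \<Rightarrow> real \<Rightarrow> bool" where
  "cone_tower m f v z \<longleftrightarrow>
     (if m = 2 then (f 0, f 1, z) \<in> power_cone (1/2)
      else (f 0, v 1, z) \<in> power_cone (1 / real m) \<and>
           (\<forall>l\<in>{2..m - 2}. (f (l - 1), v l, v (l - 1)) \<in> power_cone (1 / real (m - l + 1))) \<and>
           (f (m - 2), f (m - 1), v (m - 2)) \<in> power_cone (1/2))"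

text \<open>
  With \<open>u\<close> extending \<open>v\<close> by the constant at the bottom and the last variable at the top, the
  first and the last cone have the same shape as the inner ones.
\<close>

lemma cone_tower_iff_chain:
  assumes m: "m \<ge> 2"
    and u: "u 0 = z" "u (m - 1) = f (m - 1)" "\<forall>l\<in>{1..m - 2}. u l = v l"
  shows "cone_tower m f v z \<longleftrightarrow>
    (\<forall>l\<in>{1..m - 1}. f (l - 1) \<ge> 0 \<and> u l \<ge> 0 \<and> \<bar>u (l - 1)\<bar> ^ (m - l + 1) \<le> f (l - 1) * u l ^ (m - l))"
proof -
  have step: "(f (l - 1), u l, u (l - 1)) \<in> power_cone (1 / real (m - l + 1)) \<longleftrightarrow>
      f (l - 1) \<ge> 0 \<and> u l \<ge> 0 \<and> \<bar>u (l - 1)\<bar> ^ (m - l + 1) \<le> f (l - 1) * u l ^ (m - l)"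
    if "l \<in> {1..m - 1}" for l
  proof -
    have "m - l + 1 \<ge> 2" using that m by auto
    from power_cone_inverse_nat_iff[OF this] show ?thesis by (simp only: add_diff_cancel_right')
  qed
  have "cone_tower m f v z \<longleftrightarrow>
      (\<forall>l\<in>{1..m - 1}. (f (l - 1), u l, u (l - 1)) \<in> power_cone (1 / real (m - l + 1)))"
  proof (cases "m = 2")
    case True
    then have "{1..m - 1} = {1}" by auto
    then show ?thesis using True u by (simp add: cone_tower_def)
  next
    case False
    define P where "P l \<longleftrightarrow> (f (l - 1), u l, u (l - 1)) \<in> power_cone (1 / real (m - l + 1))" for l
    have "{1..m - 1} = {1} \<union> {2..m - 2} \<union> {m - 1}" using m False by auto
    then have "(\<forall>l\<in>{1..m - 1}. P l) \<longleftrightarrow> P 1 \<and> (\<forall>l\<in>{2..m - 2}. P l) \<and> P (m - 1)"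
      by (simp only: ball_Un) simp
    moreover have "P l \<longleftrightarrow> (f (l - 1), v l, v (l - 1)) \<in> power_cone (1 / real (m - l + 1))"
      if "l \<in> {2..m - 2}" for l
    proof -
      have "u l = v l" "u (l - 1) = v (l - 1)" using that by (auto intro!: bspec[OF u(3)])
      then show ?thesis by (simp only: P_def)
    qed
    moreover have "P 1 \<longleftrightarrow> (f 0, v 1, z) \<in> power_cone (1 / real m)"
    proof -
      have "u 1 = v 1" "m - 1 + 1 = m" "1 - 1 = (0::nat)" using m False by (auto intro!: bspec[OF u(3)])
      then show ?thesis by (simp only: P_def u(1))
    qed
    moreover have "P (m - 1) \<longleftrightarrow> (f (m - 2), f (m - 1), v (m - 2)) \<in> power_cone (1/2)"
    proof -
      have "u (m - 2) = v (m - 2)" using m False by (intro bspec[OF u(3)]) auto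
      moreover have "m - 1 - 1 = m - 2" "m - (m - 1) + 1 = 2" using m by auto
      ultimately show ?thesis by (simp only: P_def u(2) of_nat_numeral)
    qed
    ultimately show ?thesis using False unfolding cone_tower_def P_def[symmetric] by simp
  qed
  then show ?thesis using step by simp
qed

text \<open>
  The tower expresses a geometric mean of \<open>m\<close> numbers by three-dimensional cones: the inequalities
  telescope to the bound on the product, and conversely \<open>v l\<close> can be taken as the geometric mean
  of the variables at the positions from \<open>l\<close> on.
\<close>

lemma ex_cone_tower_iff:
  assumes m: "m \<ge> 2"
  shows "(\<exists>v. (\<forall>l\<in>{1..m - 2}. v l \<ge> 0) \<and> cone_tower m f v z) \<longleftrightarrow>
    (\<forall>l<m. f l \<ge> 0) \<and> \<bar>z\<bar> ^ m \<le> (\<Prod>l<m. f l)"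
proof (intro iffI; (elim exE conjE)?)
  fix v assume "cone_tower m f v z"
  define u where "u = (\<lambda>l. if l = 0 then z else if l = m - 1 then f (m - 1) else v l)"
  have "u 0 = z" "u (m - 1) = f (m - 1)" "\<forall>l\<in>{1..m - 2}. u l = v l"
    using m by (auto simp: u_def)
  from cone_tower_iff_chain[of m u z f v, OF m this] \<open>cone_tower m f v z\<close>
  have "\<forall>l\<in>{1..m - 1}. f (l - 1) \<ge> 0 \<and> u l \<ge> 0 \<and> \<bar>u (l - 1)\<bar> ^ (m - l + 1) \<le> f (l - 1) * u l ^ (m - l)"
    by (rule iffD1)
  then have chain: "f (l - 1) \<ge> 0 \<and> u l \<ge> 0 \<and> \<bar>u (l - 1)\<bar> ^ (m - l + 1) \<le> f (l - 1) * u l ^ (m - l)"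
    if "1 \<le> l" "l \<le> m - 1" for l
    using that by (simp only: atLeastAtMost_iff)
  have f0: "f l \<ge> 0" if "l < m" for l
  proof (cases "l = m - 1")
    case True
    then show ?thesis using chain[of "m - 1"] m by (auto simp: u_def)
  next
    case False
    then show ?thesis using chain[of "Suc l"] that by auto
  qed
  have "\<bar>z\<bar> ^ m \<le> (\<Prod>j<l. f j) * \<bar>u l\<bar> ^ (m - l)" if "l \<le> m - 1" for l
    using that
  proof (induction l)
    case 0
    then show ?case by (simp add: u_def)
  next
    case (Suc l)
    have "m - Suc l + 1 = m - l" using Suc.prems m by auto
    then have "\<bar>u l\<bar> ^ (m - l) \<le> f l * \<bar>u (Suc l)\<bar> ^ (m - Suc l)"
      using chain[of "Suc l"] Suc.prems by auto
    then have "(\<Prod>j<l. f j) * \<bar>u l\<bar> ^ (m - l) \<le> (\<Prod>j<l. f j) * (f l * \<bar>u (Suc l)\<bar> ^ (m - Suc l))"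
      using f0 Suc.prems by (intro mult_left_mono prod_nonneg) auto
    then show ?case using Suc by (simp add: mult.assoc)
  qed
  from this[of "m - 1"] have "\<bar>z\<bar> ^ m \<le> (\<Prod>j<m - 1. f j) * f (m - 1)"
    using m f0[of "m - 1"] by (auto simp: u_def)
  also have "\<dots> = (\<Prod>j<m. f j)" using m by (cases m) auto
  finally show "(\<forall>l<m. f l \<ge> 0) \<and> \<bar>z\<bar> ^ m \<le> (\<Prod>l<m. f l)" using f0 by blast
next
  assume f0: "\<forall>l<m. f l \<ge> 0" and z: "\<bar>z\<bar> ^ m \<le> (\<Prod>l<m. f l)"
  define R where "R l = (\<Prod>j\<in>{l..<m}. f j)" for l
  define v where "v l = root (m - l) (R l)" for l
  have R0: "R l \<ge> 0" for l unfolding R_def using f0 by (intro prod_nonneg) auto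
  have v0: "v l \<ge> 0" for l unfolding v_def by (intro real_root_ge_zero R0)
  have vR: "v l ^ (m - l) = R l" if "l < m" for l
    using that R0 by (simp add: v_def)
  have R_rec: "R l = f l * R (Suc l)" if "l < m" for l
    using that by (simp add: R_def prod.atLeast_Suc_lessThan)
  have "cone_tower m f v z"
  proof (subst cone_tower_iff_chain[OF m, where u = "v(0 := z)"])
    have "R (m - 1) = f (m - 1)" using m R_rec[of "m - 1"] by (simp add: R_def)
    moreover have "v (m - 1) ^ 1 = R (m - 1)" using vR[of "m - 1"] m by simp
    ultimately show "(v(0 := z)) (m - 1) = f (m - 1)" using m by simp
    have step: "\<bar>(v(0 := z)) (l - 1)\<bar> ^ (m - l + 1) \<le> f (l - 1) * R l"
      if l: "1 \<le> l" "l \<le> m - 1" for l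
    proof (cases "l = 1")
      case True
      then show ?thesis using z m R_rec[of 0] by (simp add: R_def atLeast0LessThan)
    next
      case False
      have "m - l + 1 = m - (l - 1)" using l False by auto
      then have "\<bar>v (l - 1)\<bar> ^ (m - l + 1) = R (l - 1)" using vR[of "l - 1"] v0 l by simp
      also have "\<dots> = f (l - 1) * R l" using R_rec[of "l - 1"] l by simp
      finally show ?thesis using False l by simp
    qed
    show "\<forall>l\<in>{1..m - 1}. f (l - 1) \<ge> 0 \<and> (v(0 := z)) l \<ge> 0 \<and>
        \<bar>(v(0 := z)) (l - 1)\<bar> ^ (m - l + 1) \<le> f (l - 1) * (v(0 := z)) l ^ (m - l)"
    proof
      fix l assume l: "l \<in> {1..m - 1}"
      then have "(v(0 := z)) l ^ (m - l) = R l" using vR[of l] by auto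
      then show "f (l - 1) \<ge> 0 \<and> (v(0 := z)) l \<ge> 0 \<and>
        \<bar>(v(0 := z)) (l - 1)\<bar> ^ (m - l + 1) \<le> f (l - 1) * (v(0 := z)) l ^ (m - l)"
        using step[of l] l f0 v0[of l] by auto
    qed
  qed auto
  then show "\<exists>v. (\<forall>l\<in>{1..m - 2}. v l \<ge> 0) \<and> cone_tower m f v z" using v0 by blast
qed

lemma c_idx_nonneg: "c_idx i \<ge> 0"
  unfolding c_idx_eq_prod_list by (intro prod_list_map_nonneg) (simp add: idx_weight_nonneg)

lemma prod_list_map_nth: "prod_list (map f i) = (\<Prod>l<length i. f (i ! l))"
  for f :: "'a \<Rightarrow> real"
  by (simp add: prod.list_conv_set_nth atLeast0LessThan)

lemma pc_feasible_iff:
  assumes m: "m \<ge> 2"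
  shows "pc_feasible (P_problem m n A) \<longleftrightarrow>
    (\<exists>d. (\<forall>k\<in>{1..n}. (\<Sum>i | i \<in> offdiag_idx m n \<and> k \<in> set i. d i k) \<le> A (replicate m k)) \<and>
         (\<forall>i\<in>offdiag_idx m n. (\<forall>k\<in>set i. d i k \<ge> 0) \<and>
            c_idx i * \<bar>A i\<bar> ^ m \<le> prod_list (map (d i) i)))"
proof -
  let ?rows = "\<lambda>d. \<forall>k\<in>{1..n}. (\<Sum>i | i \<in> offdiag_idx m n \<and> k \<in> set i. d i k) \<le> A (replicate m k)"
  let ?tower = "\<lambda>d i v. (\<forall>l\<in>{1..m - 2}. v l \<ge> 0) \<and>
      cone_tower m (\<lambda>l. d i (i ! l)) v (root m (c_idx i) * A i)"
  have tower: "(\<exists>v. ?tower d i v) \<longleftrightarrow>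
      (\<forall>k\<in>set i. d i k \<ge> 0) \<and> c_idx i * \<bar>A i\<bar> ^ m \<le> prod_list (map (d i) i)"
    if i: "i \<in> offdiag_idx m n" for d :: "nat list \<Rightarrow> nat \<Rightarrow> real" and i
  proof -
    have "\<bar>root m (c_idx i) * A i\<bar> ^ m = c_idx i * \<bar>A i\<bar> ^ m"
      using m c_idx_nonneg[of i] by (simp add: abs_mult power_mult_distrib)
    then show ?thesis unfolding ex_cone_tower_iff[OF m] prod_list_map_nth
      using offdiag_idxD(1)[OF i] by (simp add: all_set_conv_all_nth)
  qed
  have "pc_feasible (P_problem m n A) \<longleftrightarrow>
      (\<exists>d v. ?rows d \<and> (\<forall>i\<in>offdiag_idx m n. ?tower d i (v i)))"
    unfolding pc_feasible_P_problem[OF m] cone_tower_def by (intro arg_cong[where f = Ex] ext) blast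
  also have "\<dots> \<longleftrightarrow> (\<exists>d. ?rows d \<and> (\<forall>i\<in>offdiag_idx m n. \<exists>v. ?tower d i v))"
    by (simp only: ex_simps bchoice_iff)
  finally show ?thesis by (simp only: tower cong: ball_cong)
qed

section \<open>Feasible points, copositivity and dominance\<close>

lemma prod_list_map_mult:
  fixes f g :: "'a \<Rightarrow> real"
  shows "prod_list (map (\<lambda>k. f k * g k) i) = prod_list (map f i) * prod_list (map g i)"
  by (induction i) auto

lemma prod_list_map_power:
  fixes f :: "'a \<Rightarrow> real"
  shows "prod_list (map (\<lambda>k. f k ^ p) i) = prod_list (map f i) ^ p"
  by (induction i) (auto simp: power_mult_distrib)

lemma sum_list_map_eq_sum_count_real:
  fixes f :: "'a \<Rightarrow> real"
  shows "sum_list (map f i) = (\<Sum>k\<in>set i. real (count_list i k) * f k)"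
proof -
  have "sum_list (map f i) = (\<Sum>k\<in>S. real (count_list i k) * f k)" if "finite S" "set i \<subseteq> S" for S
    using that
  proof (induction i)
    case (Cons a i)
    have "(\<Sum>k\<in>S. real (count_list (a # i) k) * f k) =
        (\<Sum>k\<in>S. (if k = a then f k else 0) + real (count_list i k) * f k)"
      by (intro sum.cong) (auto simp: algebra_simps)
    then show ?case using Cons by (simp add: sum.distrib)
  qed simp
  then show ?thesis by simp
qed

lemma arith_geom_mean_list:
  fixes f :: "'a \<Rightarrow> real"
  assumes i: "i \<noteq> []" and f: "\<And>k. k \<in> set i \<Longrightarrow> f k \<ge> 0"
    and g: "g \<ge> 0" "g ^ length i \<le> prod_list (map f i)"
  shows "real (length i) * g \<le> sum_list (map f i)"
proof -
  let ?S = "{..<length i}"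
  have P: "prod_list (map f i) \<ge> 0" using f by (rule prod_list_map_nonneg)
  have "g = (g ^ length i) powr (1 / real (length i))"
  proof -
    have "g powr real (length i) = g ^ length i" using g(1) i by (intro powr_realpow') auto
    then have "(g ^ length i) powr (1 / real (length i)) = (g powr real (length i)) powr (1 / real (length i))"
      by (simp only:)
    then show ?thesis using g(1) i by (simp add: powr_powr)
  qed
  also have "\<dots> \<le> prod_list (map f i) powr (1 / real (length i))"
    using g by (intro powr_mono2) auto
  also have "\<dots> = (\<Prod>l\<in>?S. f (i ! l)) powr (1 / real (card ?S))" by (simp add: prod_list_map_nth)
  also have "\<dots> \<le> (\<Sum>l\<in>?S. f (i ! l) / real (card ?S))"
    using i f by (intro arith_geom_mean) auto
  also have "\<dots> = sum_list (map f i) / real (length i)"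
    by (simp add: sum_list_sum_nth atLeast0LessThan sum_divide_distrib)
  finally show ?thesis using i by (simp add: field_simps)
qed

text \<open>
  This is where \<open>c_idx\<close> comes from: the value \<open>d k\<close> is distributed evenly over the positions of \<open>i\<close>
  that carry \<open>k\<close>, and the arithmetic-geometric mean inequality is applied over the positions.
\<close>

lemma monomial_le_weighted_powers:
  assumes i: "i \<noteq> []" and d: "\<And>k. k \<in> set i \<Longrightarrow> d k \<ge> 0" and x: "\<And>k. x k \<ge> 0"
    and a: "c_idx i * \<bar>a\<bar> ^ length i \<le> prod_list (map d i)"
  shows "real (length i) * (idx_weight i * \<bar>a\<bar> * prod_list (map x i))
    \<le> (\<Sum>k\<in>set i. d k * x k ^ length i)"
proof -
  define p where "p = prod_list (map x i)"
  define q where "q = prod_list (map (\<lambda>k. real (count_list i k)) i)"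
  define f where "f k = d k * inverse (real (count_list i k)) * x k ^ length i" for k
  have cpos: "count_list i k > 0" if "k \<in> set i" for k
    using that by (metis count_list_0_iff gr0I)
  have p0: "p \<ge> 0" unfolding p_def using x by (intro prod_list_map_nonneg)
  have q0: "q > 0" unfolding q_def using cpos by (intro prod_list_map_pos) auto
  have inv: "prod_list (map (\<lambda>k. inverse (real (count_list j k))) i) =
      inverse (prod_list (map (\<lambda>k. real (count_list j k)) i))" for j
    by (induction i) auto
  have "c_idx i = idx_weight i ^ length i * q"
    unfolding c_idx_eq_prod_list q_def by (rule prod_list_map_scale)
  then have "(idx_weight i * \<bar>a\<bar> * p) ^ length i = c_idx i * \<bar>a\<bar> ^ length i * (inverse q * p ^ length i)"
    using q0 by (simp add: power_mult_distrib)
  also have "\<dots> \<le> prod_list (map d i) * (inverse q * p ^ length i)"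
    using a q0 p0 by (intro mult_right_mono) auto
  also have "\<dots> = prod_list (map f i)"
    unfolding f_def prod_list_map_mult prod_list_map_power inv by (simp add: p_def q_def)
  finally have "real (length i) * (idx_weight i * \<bar>a\<bar> * p) \<le> sum_list (map f i)"
    using d x p0 idx_weight_nonneg[of i]
    by (intro arith_geom_mean_list i) (auto simp: f_def intro!: mult_nonneg_nonneg)
  also have "\<dots> = (\<Sum>k\<in>set i. real (count_list i k) * f k)" by (rule sum_list_map_eq_sum_count_real)
  also have "\<dots> = (\<Sum>k\<in>set i. d k * x k ^ length i)"
  proof (intro sum.cong refl)
    fix k assume "k \<in> set i"
    then have "real (count_list i k) \<noteq> 0" using cpos by fastforce
    then show "real (count_list i k) * f k = d k * x k ^ length i" by (simp add: f_def)
  qed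
  finally show ?thesis by (simp only: p_def)
qed

lemma feasible_imp_copositive:
  assumes m: "m \<ge> 2" and feas: "pc_feasible (P_problem m n A)"
  shows "comparison_copositive m n A \<and> nonneg_diag m n A"
proof -
  obtain d where rows: "\<And>k. k \<in> {1..n} \<Longrightarrow> (\<Sum>i | i \<in> offdiag_idx m n \<and> k \<in> set i. d i k) \<le> A (replicate m k)"
    and d: "\<And>i k. i \<in> offdiag_idx m n \<Longrightarrow> k \<in> set i \<Longrightarrow> d i k \<ge> 0"
    and prod: "\<And>i. i \<in> offdiag_idx m n \<Longrightarrow> c_idx i * \<bar>A i\<bar> ^ m \<le> prod_list (map (d i) i)"
    using feas unfolding pc_feasible_iff[OF m] by blast
  have nonneg: "nonneg_diag m n A"
    unfolding nonneg_diag_def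
  proof
    fix k assume "k \<in> {1..n}"
    have "0 \<le> (\<Sum>i | i \<in> offdiag_idx m n \<and> k \<in> set i. d i k)" using d by (intro sum_nonneg) auto
    then show "A (replicate m k) \<ge> 0" using rows[OF \<open>k \<in> {1..n}\<close>] by linarith
  qed
  have "real m * (\<Sum>i\<in>offdiag_idx m n. (idx_weight i * \<bar>A i\<bar>) * prod_list (map x i))
      \<le> (\<Sum>k\<in>{1..n}. \<bar>A (replicate m k)\<bar> * x k ^ m)" if x: "\<forall>j. x j \<ge> 0" for x
  proof -
    have "real m * (\<Sum>i\<in>offdiag_idx m n. (idx_weight i * \<bar>A i\<bar>) * prod_list (map x i))
        \<le> (\<Sum>i\<in>offdiag_idx m n. \<Sum>k\<in>set i. d i k * x k ^ m)"
      unfolding sum_distrib_left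
    proof (rule sum_mono)
      fix i assume i: "i \<in> offdiag_idx m n"
      have len: "length i = m" using offdiag_idxD(1)[OF i] .
      then have "i \<noteq> []" using m by auto
      from monomial_le_weighted_powers[OF this, of "d i" x "A i"] d[OF i] x prod[OF i]
      show "real m * (idx_weight i * \<bar>A i\<bar> * prod_list (map x i)) \<le> (\<Sum>k\<in>set i. d i k * x k ^ m)"
        by (simp add: len)
    qed
    also have "\<dots> = (\<Sum>i\<in>offdiag_idx m n. \<Sum>k\<in>{k\<in>{1..n}. k \<in> set i}. d i k * x k ^ m)"
      using offdiag_idxD(2) by (intro sum.cong refl) blast
    also have "\<dots> = (\<Sum>k\<in>{1..n}. \<Sum>i | i \<in> offdiag_idx m n \<and> k \<in> set i. d i k * x k ^ m)"
      by (rule sum.swap_restrict) (auto simp: finite_offdiag_idx)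
    also have "\<dots> = (\<Sum>k\<in>{1..n}. (\<Sum>i | i \<in> offdiag_idx m n \<and> k \<in> set i. d i k) * x k ^ m)"
      by (simp add: sum_distrib_right)
    also have "\<dots> \<le> (\<Sum>k\<in>{1..n}. \<bar>A (replicate m k)\<bar> * x k ^ m)"
      using x rows by (intro sum_mono mult_right_mono) (auto intro: order_trans[OF _ abs_ge_self])
    finally show ?thesis .
  qed
  then show ?thesis using nonneg unfolding comparison_copositive_def by blast
qed

text \<open>
  A scaling \<open>x\<close> distributes the diagonal: \<open>d i k\<close> is the share of \<open>i\<close> in row \<open>k\<close>, normalized by
  \<open>x k ^ m\<close>. In the product over the positions of \<open>i\<close> the powers of \<open>x\<close> cancel and the tower
  constraint holds with equality.
\<close>

lemma dominance_imp_feasible: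
  assumes m: "m \<ge> 2" and dom: "scaled_dominance m n A x" and A: "nonneg_diag m n A"
  shows "pc_feasible (P_problem m n A)"
proof -
  define p where "p i = \<bar>A i\<bar> * prod_list (map x i)" for i
  define d where "d i k = idx_weight i * real (count_list i k) * (p i * inverse (x k) ^ m)" for i k
  have x: "x k > 0" if "k \<in> {1..n}" for k using dom that by (simp add: scaled_dominance_def)
  have xi: "x k > 0" if "i \<in> offdiag_idx m n" "k \<in> set i" for i k
    using x offdiag_idxD(2)[OF that(1)] that(2) by blast
  have p0: "p i \<ge> 0" if "i \<in> offdiag_idx m n" for i
    unfolding p_def using xi[OF that] by (intro mult_nonneg_nonneg prod_list_map_nonneg) (auto simp: less_imp_le)
  have "(\<Sum>i | i \<in> offdiag_idx m n \<and> k \<in> set i. d i k) \<le> A (replicate m k)" if k: "k \<in> {1..n}" for k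
  proof -
    have "(\<Sum>i | i \<in> offdiag_idx m n \<and> k \<in> set i. d i k) = (\<Sum>i\<in>offdiag_idx m n. d i k)"
      by (intro sum.mono_neutral_left finite_offdiag_idx) (auto simp: d_def count_list_0_iff)
    also have "\<dots> = offdiag_row m n A x k * inverse (x k) ^ m"
      unfolding offdiag_row_def sum_distrib_right
      by (intro sum.cong refl) (simp add: d_def p_def mult_ac)
    also have "\<dots> \<le> \<bar>A (replicate m k)\<bar> * x k ^ m * inverse (x k) ^ m"
      using dom k less_imp_le[OF x[OF k]] by (intro mult_right_mono) (auto simp: scaled_dominance_def)
    also have "\<dots> = A (replicate m k)"
      using x[OF k] A k by (simp add: nonneg_diag_def power_inverse)
    finally show ?thesis .
  qed
  moreover have "d i k \<ge> 0" if "i \<in> offdiag_idx m n" "k \<in> set i" for i k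
    unfolding d_def using p0[OF that(1)] xi[OF that] idx_weight_nonneg[of i]
    by (intro mult_nonneg_nonneg) auto
  moreover have "prod_list (map (d i) i) = c_idx i * \<bar>A i\<bar> ^ m" if i: "i \<in> offdiag_idx m n" for i
  proof -
    have len: "length i = m" using offdiag_idxD(1)[OF i] .
    have pos: "prod_list (map x i) > 0" using xi[OF i] by (intro prod_list_map_pos)
    have inv: "prod_list (map (\<lambda>k. inverse (x k)) i) = inverse (prod_list (map x i))"
      by (induction i) auto
    have "prod_list (map (d i) i) = c_idx i * (p i ^ m * inverse (prod_list (map x i)) ^ m)"
      unfolding d_def prod_list_map_mult[of "\<lambda>k. idx_weight i * real (count_list i k)"]
        prod_list_map_scale prod_list_map_power inv len
      by (simp add: c_idx_eq_prod_list prod_list_map_scale len)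
    also have "p i ^ m * inverse (prod_list (map x i)) ^ m = \<bar>A i\<bar> ^ m"
    proof -
      have "p i * inverse (prod_list (map x i)) = \<bar>A i\<bar>" using pos by (simp add: p_def mult.assoc)
      then show ?thesis by (simp only: power_mult_distrib[symmetric])
    qed
    finally show ?thesis .
  qed
  ultimately show ?thesis unfolding pc_feasible_iff[OF m] by (intro exI[of _ d]) auto
qed

section \<open>The size of the problem\<close>

lemma P_lins_eq_UN:
  "P_lins m n A = P_row m n A ` {1..n} \<union>
     (\<Union>i\<in>offdiag_idx m n. (\<lambda>l. aff_var (VVar i l)) ` {1..m - 2})"
  unfolding P_lins_def by blast

lemma power_cone_problem_P_problem:
  assumes m: "m \<ge> 2"
  shows "power_cone_problem (P_problem m n A)"
proof -
  have idx: "i ! l \<in> set i" if "i \<in> offdiag_idx m n" "l < m" for i l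
    using that offdiag_idxD(1)[OF that(1)] by simp
  have D: "affine_over (P_vars m n) (aff_var (DVar i (i ! l)))" if "i \<in> offdiag_idx m n" "l < m" for i l
    using that idx[OF that] by (auto simp: affine_over_def aff_var_def P_vars_def)
  have V: "affine_over (P_vars m n) (aff_var (VVar i l))" if "i \<in> offdiag_idx m n" "1 \<le> l" "l \<le> m - 2" for i l
    using that by (auto simp: affine_over_def aff_var_def P_vars_def)
  have const: "affine_over V (aff_const b)" for V :: "pvar set" and b
    by (simp add: affine_over_def aff_const_def)
  have row: "affine_over (P_vars m n) (P_row m n A j)" for j
    by (auto simp: affine_over_def P_row_def P_vars_def)
  have fin_lins: "finite (P_lins m n A)" by (simp add: P_lins_eq_UN finite_offdiag_idx)
  have fin_cones: "finite (P_idx_cones m A i)" for i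
    by (simp add: P_idx_cones_def Let_def Setcompr_eq_image)
  have lins: "affine_over (P_vars m n) e" if "e \<in> P_lins m n A" for e
    using that row V by (auto simp: P_lins_def)
  have cones: "0 \<le> \<alpha> \<and> \<alpha> \<le> 1 \<and> affine_over (P_vars m n) e1 \<and> affine_over (P_vars m n) e2 \<and>
      affine_over (P_vars m n) e3"
    if i: "i \<in> offdiag_idx m n" and e: "(\<alpha>, e1, e2, e3) \<in> P_idx_cones m A i" for i \<alpha> e1 e2 e3
  proof (cases "m = 2")
    case True
    then show ?thesis using e D[OF i, of 0] D[OF i, of 1] const by (auto simp: P_idx_cones_def)
  next
    case False
    then have m3: "m \<ge> 3" using m by simp
    from e consider "\<alpha> = 1 / real m" "e1 = aff_var (DVar i (i ! 0))" "e2 = aff_var (VVar i 1)"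
        "e3 = aff_const (root m (c_idx i) * A i)"
      | l where "l \<in> {2..m - 2}" "\<alpha> = 1 / real (m - l + 1)" "e1 = aff_var (DVar i (i ! (l - 1)))"
        "e2 = aff_var (VVar i l)" "e3 = aff_var (VVar i (l - 1))"
      | "\<alpha> = 1 / 2" "e1 = aff_var (DVar i (i ! (m - 1 - 1)))" "e2 = aff_var (DVar i (i ! (m - 1)))"
        "e3 = aff_var (VVar i (m - 2))"
      using False unfolding P_idx_cones_def Let_def by auto
    then show ?thesis
    proof cases
      case 1
      then show ?thesis using D[OF i, of 0] V[OF i, of 1] const m3 by simp
    next
      case 2
      then show ?thesis using D[OF i, of "l - 1"] V[OF i, of l] V[OF i, of "l - 1"] by auto
    next
      case 3
      then show ?thesis using D[OF i, of "m - 1 - 1"] D[OF i, of "m - 1"] V[OF i, of "m - 2"] m3 by simp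
    qed
  qed
  show ?thesis
    unfolding power_cone_problem_def P_problem_def
    using fin_lins fin_cones finite_offdiag_idx finite_P_vars lins cones by fastforce
qed

lemma card_offdiag_idx_le: "card (offdiag_idx m n) \<le> n ^ m"
proof -
  have "card (offdiag_idx m n) \<le> card (tensor_idx m n)"
    by (intro card_mono finite_tensor_idx) (auto simp: offdiag_idx_def)
  also have "\<dots> = n ^ m"
    using card_lists_length_eq[of "{1..n}" m] by (simp add: tensor_idx_def conj_commute)
  finally show ?thesis .
qed

lemma card_UN_offdiag_le:
  assumes "\<And>i. i \<in> offdiag_idx m n \<Longrightarrow> card (F i) \<le> c"
  shows "card (\<Union>i\<in>offdiag_idx m n. F i) \<le> c * n ^ m"
proof -
  have "card (\<Union>i\<in>offdiag_idx m n. F i) \<le> (\<Sum>i\<in>offdiag_idx m n. card (F i))"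
    by (intro card_UN_le finite_offdiag_idx)
  also have "\<dots> \<le> card (offdiag_idx m n) * c"
    using sum_bounded_above[of "offdiag_idx m n" "\<lambda>i. card (F i)" c] assms by simp
  also have "\<dots> \<le> n ^ m * c" by (intro mult_right_mono card_offdiag_idx_le) simp
  finally show ?thesis by (simp add: mult.commute)
qed

lemma card_P_vars_le: "card (P_vars m n) \<le> 2 * m * n ^ m"
proof -
  have "P_vars m n = (\<Union>i\<in>offdiag_idx m n. DVar i ` set i \<union> VVar i ` {1..m - 2})"
    by (auto simp: P_vars_def)
  also have "card \<dots> \<le> 2 * m * n ^ m"
  proof (rule card_UN_offdiag_le)
    fix i assume "i \<in> offdiag_idx m n"
    then have "card (set i) \<le> m" using offdiag_idxD(1) card_length by blast
    then have "card (DVar i ` set i) \<le> m" using card_image_le[of "set i" "DVar i"] by simp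
    moreover have "card (VVar i ` {1..m - 2}) \<le> m - 2" using card_image_le[of "{1..m - 2}" "VVar i"] by simp
    ultimately show "card (DVar i ` set i \<union> VVar i ` {1..m - 2}) \<le> 2 * m"
      using card_Un_le[of "DVar i ` set i" "VVar i ` {1..m - 2}"] by linarith
  qed
  finally show ?thesis .
qed

lemma card_P_lins_le: "card (P_lins m n A) \<le> n + 2 * m * n ^ m"
proof -
  have "card (P_lins m n A) \<le> card (P_row m n A ` {1..n}) +
      card (\<Union>i\<in>offdiag_idx m n. (\<lambda>l. aff_var (VVar i l)) ` {1..m - 2} :: pvar affine set)"
    unfolding P_lins_eq_UN by (rule card_Un_le)
  also have "\<dots> \<le> n + 2 * m * n ^ m"
  proof (rule add_mono)
    show "card (P_row m n A ` {1..n}) \<le> n" using card_image_le[of "{1..n}" "P_row m n A"] by simp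
    show "card (\<Union>i\<in>offdiag_idx m n. (\<lambda>l. aff_var (VVar i l)) ` {1..m - 2} :: pvar affine set) \<le> 2 * m * n ^ m"
    proof (rule card_UN_offdiag_le)
      fix i
      have "card ((\<lambda>l. aff_var (VVar i l)) ` {1..m - 2} :: pvar affine set) \<le> card {1..m - 2}"
        by (rule card_image_le) simp
      then show "card ((\<lambda>l. aff_var (VVar i l)) ` {1..m - 2} :: pvar affine set) \<le> 2 * m" by simp
    qed
  qed
  finally show ?thesis .
qed

lemma card_P_idx_cones_le:
  assumes m: "m \<ge> 2"
  shows "card (P_idx_cones m A i) \<le> 2 * m"
proof (cases "m = 2")
  case False
  have *: "card ({a} \<union> {F l | l. l \<in> S} \<union> {b}) \<le> card S + 2" if "finite S"
    for a b and F :: "nat \<Rightarrow> 'b" and S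
  proof -
    have "card ({a} \<union> {F l | l. l \<in> S} \<union> {b}) \<le> Suc (Suc (card (F ` S)))"
      using that by (simp add: Setcompr_eq_image card_insert_if)
    then show ?thesis using card_image_le[OF that, of F] by linarith
  qed
  have "card (P_idx_cones m A i) \<le> card {2..m - 2} + 2"
    unfolding P_idx_cones_def Let_def if_not_P[OF False] by (rule *) simp
  then show ?thesis using m by simp
qed (simp add: P_idx_cones_def)

theorem theorem7:
  fixes m :: nat
  assumes "m \<ge> 2"
  shows "\<exists>p :: real poly. \<forall>n :: nat. \<forall>A :: tensor. symmetric_tensor m n A \<longrightarrow>
     (Hplus_tensor m n A \<longleftrightarrow> GDDplus_tensor m n A) \<and>
     (Hplus_tensor m n A \<longleftrightarrow> pc_feasible (P_problem m n A)) \<and>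
     power_cone_problem (P_problem m n A) \<and>
     real (card (pc_vars (P_problem m n A))) \<le> poly p (real n) \<and>
     real (card (pc_lins (P_problem m n A))) \<le> poly p (real n) \<and>
     real (card (pc_cones (P_problem m n A))) \<le> poly p (real n)"
proof (intro exI[of _ "monom 1 1 + monom (real (2 * m)) m"] allI impI)
  fix n :: nat and A :: tensor
  assume A: "symmetric_tensor m n A"
  note m = assms
  have H_dom: "H_tensor m n A \<longleftrightarrow> (\<exists>d. scaled_dominance m n A d)"
    using H_tensor_imp_copositive[OF A m] copositive_imp_dominance[OF m]
      dominance_imp_H_tensor[OF A m] by blast
  then have "Hplus_tensor m n A \<longleftrightarrow> GDDplus_tensor m n A"
    by (simp add: Hplus_tensor_def GDDplus_tensor_def GDD_iff_scaled_dominance[OF A m])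
  moreover have "Hplus_tensor m n A \<longleftrightarrow> pc_feasible (P_problem m n A)"
    using H_dom dominance_imp_feasible[OF m] feasible_imp_copositive[OF m]
      copositive_imp_dominance[OF m] unfolding Hplus_tensor_def by blast
  moreover have bound: "real N \<le> poly (monom 1 1 + monom (real (2 * m)) m) (real n)"
    if "N \<le> n + 2 * m * n ^ m" for N
  proof -
    have "real N \<le> real (n + 2 * m * n ^ m)" using that by (simp only: of_nat_le_iff)
    then show ?thesis by (simp add: poly_monom)
  qed
  ultimately show "(Hplus_tensor m n A \<longleftrightarrow> GDDplus_tensor m n A) \<and>
     (Hplus_tensor m n A \<longleftrightarrow> pc_feasible (P_problem m n A)) \<and>
     power_cone_problem (P_problem m n A) \<and>
     real (card (pc_vars (P_problem m n A))) \<le> poly (monom 1 1 + monom (real (2 * m)) m) (real n) \<and>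
     real (card (pc_lins (P_problem m n A))) \<le> poly (monom 1 1 + monom (real (2 * m)) m) (real n) \<and>
     real (card (pc_cones (P_problem m n A))) \<le> poly (monom 1 1 + monom (real (2 * m)) m) (real n)"
    using power_cone_problem_P_problem[OF m] card_P_vars_le[of m n] card_P_lins_le[of m n A]
      card_UN_offdiag_le[of m n "P_idx_cones m A" "2 * m", OF card_P_idx_cones_le[OF m]]
    by (intro conjI bound) (auto simp: P_problem_def)
qed

end
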